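(* For every $\rho\in(-1,-1/2]$, one has $$\mathcal{N}_{\rho,\beta,+}=1\quad\text{for all }\beta\in[-1,0),\qquad\text{and}\qquad \mathcal{N}_{\rho,\beta,+}=2\quad\text{for all }\beta\in[2\rho,-1),$$ where $\mathcal{N}_{\rho,\beta,+}=\sharp\{x>0:\ \phi(\rho,\beta,-x)=0\}$.
   Context: The Wright function is the entire function $\phi(\rho,\beta,z)=\sum_{n\ge 0}\frac{z^n}{n!\,\Gamma(\beta+\rho n)}$, $\rho>-1$, $\beta,z\in\mathbb{C}$, where $1/\Gamma$ is the entire reciprocal Gamma function (equal to $0$ at the non-positive integers). $\sharp A$ denotes the cardinality of the set $A$ (zeroes are counted without multiplicity). *)

theory Defs
  imports "HOL-Analysis.Analysis"
begin

definition wright :: "real \<Rightarrow> complex \<Rightarrow> complex \<Rightarrow> complex" where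
  "wright \<rho> \<beta> z = (\<Sum>n. z ^ n / fact n * rGamma (\<beta> + of_real \<rho> * of_nat n))"

(* Since card of an infinite set is 0, a value of num_pos_zeros other than 0
   also says that the set of zeros is finite. *)
definition num_pos_zeros :: "real \<Rightarrow> complex \<Rightarrow> nat" where
  "num_pos_zeros \<rho> \<beta> = card {x :: real. x > 0 \<and> wright \<rho> \<beta> (- of_real x) = 0}"

end

theory Submission
  imports Defs "HOL-Complex_Analysis.Cauchy_Integral_Theorem" "HOL-Real_Asymp.Real_Asymp"
begin

text \<open>
  Put \<open>a = -\<rho>\<close> and \<open>b = -\<beta>\<close>. Hankel's formula for the reciprocal Gamma function writes
  \<open>\<pi> \<phi>(-a, -b, -x)\<close> as the imaginary part of an integral of \<open>s\<^sup>b exp (s - x s\<^sup>a)\<close> along the upper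
  side of the negative axis. With \<open>x = X\<^bsup>1-a\<^esup>\<close>, moving the path to the steepest descent curve
  \<open>s = X R(p) e\<^bsup>ip\<^esup>\<close>, \<open>0 < p < \<pi>\<close>, turns it into the Laplace type integral
  \<open>X\<^bsup>b+1\<^esup> \<integral> exp (-X A(p)) w(p) dp\<close> with \<open>A\<close> strictly increasing and bounded below by a positive
  constant. The weight \<open>w(p)\<close> is a positive multiple of \<open>cos (b p + arctan E(p))\<close>, where \<open>E\<close> is
  increasing, so it has at most one sign change for \<open>0 < b \<le> 1\<close> and at most two for \<open>b < 2\<close>.

  By Descartes' rule for Laplace transforms this bounds the number of zeros from above: if there were
  one zero more than sign changes, some linear combination of the corresponding exponentials would
  change sign exactly where the weight does, and would integrate to zero against it. The integrals
  never appear explicitly; they are replaced by the imaginary part of a primitive of the integrand,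
  viewed as a function of \<open>p\<close>.

  The lower bound is Rolle's theorem for \<open>x\<^bsup>b/a\<^esup> \<phi>(-a, 1-b, -x)\<close>: it vanishes at \<open>0\<close> and at
  infinity, and its derivative is \<open>-x\<^bsup>b/a-1\<^esup> \<phi>(-a, -b, -x) / a\<close>. For \<open>1 < b < 2\<close> it has a further
  zero in between.
\<close>

section \<open>Real functions\<close>


text \<open>The derivative \<open>k * (cos (k * t) - cos t)\<close> of the difference is nonnegative
  because cosine decreases on [0, pi]. This estimate makes \<open>E\<close> increasing and bounds
  \<open>ell\<close> and \<open>A\<close> from below.\<close>

lemma sin_mult_concave:
  fixes k p :: real
  assumes "0 \<le> k" "k \<le> 1" "0 \<le> p" "p \<le> pi"
  shows "k * sin p \<le> sin (k * p)"
proof -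
  let ?f = "\<lambda>t. sin (k * t) - k * sin t"
  have "?f 0 \<le> ?f p"
  proof (rule DERIV_nonneg_imp_nondecreasing[OF assms(3)])
    fix t :: real assume t: "0 \<le> t" "t \<le> p"
    have "cos t \<le> cos (k * t)"
      using t assms by (intro cos_monotone_0_pi_le) (auto simp: mult_left_le_one_le)
    then have "0 \<le> k * (cos (k * t) - cos t)" using assms by simp
    moreover have "(?f has_real_derivative k * (cos (k * t) - cos t)) (at t)"
      by (auto intro!: derivative_eq_intros simp: algebra_simps)
    ultimately show "\<exists>y. (?f has_real_derivative y) (at t) \<and> 0 \<le> y" by blast
  qed
  then show ?thesis by simp
qed

lemma mult_in_0_pi:
  fixes k p :: real
  assumes "0 < k" "k < 1" "0 < p" "p < pi"
  shows "0 < k * p" "k * p < p" "k * p < pi"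
proof -
  show "0 < k * p" using assms by simp
  show "k * p < p" using assms by simp
  then show "k * p < pi" using assms by linarith
qed

text \<open>Clearing the positive denominators leaves a function that vanishes at 0 and has
  derivative \<open>(1 - k^2) * (sin (k * t) * sin t)\<close>. It yields the positivity of
  \<open>ell'\<close> and of \<open>E\<close>.\<close>

lemma mult_cot_gt:
  fixes k p :: real
  assumes "0 < k" "k < 1" "0 < p" "p < pi"
  shows "cot p < k * cot (k * p)"
proof -
  let ?f = "\<lambda>t. k * cos (k * t) * sin t - sin (k * t) * cos t"
  have "?f 0 < ?f p"
  proof (rule DERIV_pos_imp_increasing_open[OF assms(3)])
    fix t :: real assume t: "0 < t" "t < p"
    note kt = mult_in_0_pi[OF assms(1,2) t(1)]
    have "0 < (1 - k^2) * (sin (k * t) * sin t)"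
      using t assms kt by (intro mult_pos_pos sin_gt_zero) (auto simp: power_less_one_iff)
    moreover have "(?f has_real_derivative (1 - k^2) * (sin (k * t) * sin t)) (at t)"
      by (auto intro!: derivative_eq_intros simp: algebra_simps power2_eq_square)
    ultimately show "\<exists>y. (?f has_real_derivative y) (at t) \<and> 0 < y" by blast
  qed (auto intro!: continuous_intros)
  moreover have "0 < sin p" "0 < sin (k * p)"
    using assms mult_in_0_pi[OF assms] by (auto intro: sin_gt_zero)
  ultimately show ?thesis
    by (simp add: cot_def field_simps)
qed

text \<open>Stands in for the positivity of the integral of a nonnegative function: if the two
  limits agreed, the monotone \<open>g\<close> would be constant. The ends are described by filters,
  so that bounded intervals and half-lines can be treated alike.\<close>

lemma deriv_nonneg_limits:
  fixes g g' :: "real \<Rightarrow> real"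
  assumes "convex S"
    and der: "\<And>p. p \<in> S \<Longrightarrow> (g has_real_derivative g' p) (at p)"
    and nonneg: "\<And>p. p \<in> S \<Longrightarrow> 0 \<le> g' p"
    and L: "L \<noteq> bot" "\<And>p. p \<in> S \<Longrightarrow> eventually (\<lambda>x. x \<in> S \<and> x \<le> p) L" "(g \<longlongrightarrow> a) L"
    and R: "R \<noteq> bot" "\<And>p. p \<in> S \<Longrightarrow> eventually (\<lambda>x. x \<in> S \<and> p \<le> x) R" "(g \<longlongrightarrow> b) R"
    and p: "p \<in> S"
  shows "a \<le> b" "g' p \<noteq> 0 \<Longrightarrow> open S \<Longrightarrow> a < b"
proof -
  have mono: "g x \<le> g y" if "x \<in> S" "y \<in> S" "x \<le> y" for x y
  proof (rule DERIV_nonneg_imp_nondecreasing[OF that(3)])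
    fix t assume "x \<le> t" "t \<le> y"
    then have "t \<in> S"
      using that \<open>convex S\<close> by (meson is_interval_convex_1 mem_is_interval_1_I)
    then show "\<exists>y. (g has_real_derivative y) (at t) \<and> 0 \<le> y" using der nonneg by blast
  qed
  have lo: "a \<le> g q" if "q \<in> S" for q
    by (rule tendsto_upperbound[OF L(3) _ L(1)])
      (use L(2)[OF that] in eventually_elim, use that mono in auto)
  have hi: "g q \<le> b" if "q \<in> S" for q
    by (rule tendsto_lowerbound[OF R(3) _ R(1)])
      (use R(2)[OF that] in eventually_elim, use that mono in auto)
  show "a \<le> b" using lo[OF p] hi[OF p] by simp
  show "a < b" if "g' p \<noteq> 0" "open S"
  proof (rule ccontr)
    assume "\<not> a < b"
    then have const: "g q = a" if "q \<in> S" for q using lo[OF that] hi[OF that] by simp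
    have "((\<lambda>_. a) has_real_derivative g' p) (at p)"
      by (rule has_field_derivative_transform_within_open[OF der[OF p] \<open>open S\<close> p]) (simp add: const)
    then have "g' p = 0" using DERIV_unique DERIV_const by blast
    then show False using that by simp
  qed
qed

lemma deriv_nonneg_limits_interval:
  fixes g g' :: "real \<Rightarrow> real"
  assumes "l < r"
    and "\<And>p. l < p \<Longrightarrow> p < r \<Longrightarrow> (g has_real_derivative g' p) (at p)"
    and "\<And>p. l < p \<Longrightarrow> p < r \<Longrightarrow> 0 \<le> g' p"
    and "(g \<longlongrightarrow> a) (at_right l)" "(g \<longlongrightarrow> b) (at_left r)"
  shows "a \<le> b" "l < p \<Longrightarrow> p < r \<Longrightarrow> g' p \<noteq> 0 \<Longrightarrow> a < b"
proof -
  have ev: "\<And>p. p \<in> {l<..<r} \<Longrightarrow> eventually (\<lambda>x. x \<in> {l<..<r} \<and> x \<le> p) (at_right l)"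
    "\<And>p. p \<in> {l<..<r} \<Longrightarrow> eventually (\<lambda>x. x \<in> {l<..<r} \<and> p \<le> x) (at_left r)"
    subgoal for p by (rule eventually_mono[OF eventually_at_right_real[of l p]]) auto
    subgoal for p by (rule eventually_mono[OF eventually_at_left_real[of p r]]) auto
    done
  have *: "a \<le> b \<and> (g' q \<noteq> 0 \<longrightarrow> a < b)" if "q \<in> {l<..<r}" for q
    using deriv_nonneg_limits[of "{l<..<r}" g g' "at_right l" a "at_left r" b q] assms ev that
    by auto
  obtain q where "q \<in> {l<..<r}" using dense[OF assms(1)] by auto
  then show "a \<le> b" using * by blast
  show "l < p \<Longrightarrow> p < r \<Longrightarrow> g' p \<noteq> 0 \<Longrightarrow> a < b" using *[of p] by simp
qed

section \<open>The steepest descent curve\<close>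


locale wright_index =
  fixes a :: real
  assumes a: "0 < a" "a < 1"
begin

text \<open>The curve is \<open>s = exp (ell p + i p)\<close>, on which \<open>s - s\<^sup>a\<close> takes the real value \<open>-A p\<close>.
  The functions \<open>ell'\<close> and \<open>E\<close> are exchanged by replacing \<open>a\<close> with \<open>1 - a\<close>.\<close>
definition ell :: "real \<Rightarrow> real" where
  "ell p = ln (sin (a * p) / sin p) / (1 - a)"

definition ell' :: "real \<Rightarrow> real" where
  "ell' p = (a * cot (a * p) - cot p) / (1 - a)"

definition E :: "real \<Rightarrow> real" where
  "E p = ((1 - a) * cot ((1 - a) * p) - cot p) / a"

definition A :: "real \<Rightarrow> real" where
  "A p = exp (a * ell p) * sin ((1 - a) * p) / sin p"

text \<open>The imaginary part of \<open>s\<^sup>b ds/dp\<close> on the curve.\<close>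
definition w :: "real \<Rightarrow> real \<Rightarrow> real" where
  "w b p = exp ((b + 1) * ell p) * (ell' p * sin ((b + 1) * p) + cos ((b + 1) * p))"

text \<open>The argument of \<open>s^b ds/dp\<close> on the curve, lowered by pi/2; the imaginary
  part \<open>w\<close> therefore has the sign of its cosine.\<close>

definition phase :: "real \<Rightarrow> real \<Rightarrow> real" where
  "phase b p = b * p + arctan (E p)"

lemma sin_pos:
  assumes "0 < p" "p < pi"
  shows "0 < sin p" "0 < sin (a * p)" "0 < sin ((1 - a) * p)"
proof -
  show "0 < sin p" using assms by (rule sin_gt_zero)
  show "0 < sin (a * p)"
    using mult_in_0_pi[OF a assms] by (intro sin_gt_zero) auto
  show "0 < sin ((1 - a) * p)"
    using mult_in_0_pi[of "1 - a", OF _ _ assms] a by (intro sin_gt_zero) auto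
qed

lemma ell'_pos: "0 < p \<Longrightarrow> p < pi \<Longrightarrow> 0 < ell' p"
  using mult_cot_gt[OF a] a by (simp add: ell'_def)

lemma E_pos: "0 < p \<Longrightarrow> p < pi \<Longrightarrow> 0 < E p"
  using mult_cot_gt[of "1 - a"] a by (simp add: E_def)

lemma exp_ell:
  assumes "0 < p" "p < pi"
  shows "exp ((1 - a) * ell p) = sin (a * p) / sin p"
  using sin_pos[OF assms] a by (simp add: ell_def)

lemma DERIV_mult_cot:
  assumes "sin (k * p) \<noteq> 0"
  shows "((\<lambda>p. k * cot (k * p)) has_real_derivative - (k^2 / (sin (k * p))^2)) (at p)"
proof -
  have "((\<lambda>p. k * (cos (k * p) / sin (k * p))) has_real_derivative
     k * ((- sin (k * p) * k * sin (k * p) - cos (k * p) * (cos (k * p) * k)) / (sin (k * p) * sin (k * p)))) (at p)"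
    using assms by (intro DERIV_cmult) (auto intro!: derivative_eq_intros)
  also have "- sin (k * p) * k * sin (k * p) - cos (k * p) * (cos (k * p) * k)
     = - (k * ((sin (k * p))^2 + (cos (k * p))^2))"
    unfolding power2_eq_square by algebra
  also have "k * (- (k * ((sin (k * p))^2 + (cos (k * p))^2)) / (sin (k * p) * sin (k * p))) = - (k^2 / (sin (k * p))^2)"
    by (simp only: sin_cos_squared_add) (simp add: power2_eq_square)
  finally show ?thesis by (simp add: cot_def)
qed

lemma ell_deriv:
  assumes "0 < p" "p < pi"
  shows "(ell has_real_derivative ell' p) (at p)"
proof -
  note s = sin_pos[OF assms]
  have "((\<lambda>p. (ln (sin (a * p)) - ln (sin p)) / (1 - a)) has_real_derivative ell' p) (at p)"
    unfolding ell'_def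
    by (rule DERIV_cdivide, use s in \<open>auto intro!: derivative_eq_intros simp: cot_def divide_inverse mult_ac\<close>)
  then show ?thesis
  proof (rule has_field_derivative_transform_within_open[of _ _ _ "{0<..<pi}"])
    fix q assume "q \<in> {0<..<pi}"
    then show "(ln (sin (a * q)) - ln (sin q)) / (1 - a) = ell q"
      using sin_pos[of q] by (simp add: ell_def ln_div)
  qed (use assms in auto)
qed

text \<open>With \<open>k = 1 - a\<close> the derivative is
  \<open>(1 / sin^2 p - k^2 / sin^2 (k p)) / a\<close>, which is nonnegative by
  \<open>sin_mult_concave\<close>.\<close>

lemma E_deriv:
  assumes "0 < p" "p < pi"
  shows "\<exists>d\<ge>0. (E has_real_derivative d) (at p)"
proof -
  note s = sin_pos[OF assms]
  have "(E has_real_derivative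
      (- ((1 - a)^2 / (sin ((1 - a) * p))^2) - - (1^2 / (sin (1 * p))^2)) / a) (at p)"
    unfolding E_def
    using s DERIV_mult_cot[of 1 p] by (intro DERIV_cdivide DERIV_diff DERIV_mult_cot) auto
  moreover have "(1 - a) / sin ((1 - a) * p) \<le> 1 / sin p"
    using sin_mult_concave[of "1 - a" p] s a assms by (simp add: field_simps)
  then have "((1 - a) / sin ((1 - a) * p))^2 \<le> (1 / sin p)^2"
    using s a by (intro power_mono) auto
  ultimately show ?thesis
    using a by (intro exI conjI) (auto simp: power_divide)
qed

lemma phase_deriv:
  assumes "0 < p" "p < pi"
  shows "\<exists>d\<ge>b. (phase b has_real_derivative d) (at p)"
proof -
  obtain d where d: "d \<ge> 0" "(E has_real_derivative d) (at p)" using E_deriv[OF assms] by blast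
  have "(phase b has_real_derivative b + d * inverse (1 + (E p)^2)) (at p)"
    unfolding phase_def by (auto intro!: derivative_eq_intros d)
  moreover have "0 \<le> d * inverse (1 + (E p)^2)" using d by simp
  ultimately show ?thesis by (intro exI[of _ "b + d * inverse (1 + (E p)^2)"]) auto
qed

lemma phase_strict_mono:
  assumes "0 < b" "0 < p" "p < q" "q < pi"
  shows "phase b p < phase b q"
proof (rule DERIV_pos_imp_increasing[OF assms(3)])
  fix x assume "p \<le> x" "x \<le> q"
  then obtain d where "d \<ge> b" "(phase b has_real_derivative d) (at x)"
    using phase_deriv[of x b] assms by auto
  then show "\<exists>y. (phase b has_real_derivative y) (at x) \<and> 0 < y"
    using assms(1) by (intro exI[of _ d]) auto
qed

lemma phase_continuous: "continuous_on {0<..<pi} (phase b)"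
  by (rule continuous_at_imp_continuous_on) (meson DERIV_isCont phase_deriv greaterThanLessThan_iff)

text \<open>The tangent of the steepest descent curve has argument \<open>p + \<pi>/2 - arctan (ell' p)\<close>, and
  \<open>arctan (E p) = p - arctan (ell' p)\<close>.\<close>
lemma w_eq_cos_phase:
  assumes "0 < p" "p < pi"
  obtains v where "0 < v" "w b p = v * cos (phase b p)"
proof
  note s = sin_pos[OF assms]
  \<comment> \<open>The tangent direction \<open>e^(ip) (ell' p + i)\<close> will turn out to be
    \<open>i V (1 + i E p)\<close>. Its imaginary and real parts are the facts \<open>V\<close> and
    \<open>E\<close> below, and this closed form of \<open>V\<close> is visibly positive.\<close>
  define V where "V = a * sin ((1 - a) * p) / ((1 - a) * sin (a * p))"
  let ?v = "exp ((b + 1) * ell p) * V * sqrt (1 + (E p)^2)"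
  have "0 < V" using s a by (simp add: V_def)
  then show "0 < ?v" by (intro mult_pos_pos) (auto intro: add_pos_nonneg)
  have sd: "sin ((1 - a) * p) = sin p * cos (a * p) - cos p * sin (a * p)"
    and cd: "cos ((1 - a) * p) = cos p * cos (a * p) + sin p * sin (a * p)"
    using sin_diff[of p "a * p"] cos_diff[of p "a * p"] by (simp_all add: algebra_simps)
  have k: "1 - a \<noteq> 0" "a \<noteq> 0" "sin p \<noteq> 0" "sin (a * p) \<noteq> 0" "sin ((1 - a) * p) \<noteq> 0" using s a by auto
  have L: "ell' p * sin p * ((1 - a) * sin (a * p)) = a * cos (a * p) * sin p - cos p * sin (a * p)"
    unfolding ell'_def cot_def using k by (simp add: divide_simps; simp add: algebra_simps)
  have "(ell' p * sin p + cos p) * ((1 - a) * sin (a * p)) = a * sin ((1 - a) * p)"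
    using L unfolding sd by (simp add: algebra_simps)
  then have V: "ell' p * sin p + cos p = V"
    using k by (simp add: V_def eq_divide_eq)
  have "V * E p * ((1 - a) * sin (a * p) * sin p) = (a * E p * sin ((1 - a) * p)) * sin p"
    using k by (simp add: V_def)
  also have "\<dots> = (1 - a) * cos ((1 - a) * p) * sin p - cos p * sin ((1 - a) * p)"
    unfolding E_def cot_def using k by (simp add: divide_simps; simp add: algebra_simps)
  also have "\<dots> = (1 - a) * sin (a * p) * (sin p)^2 - cos p * (a * cos (a * p) * sin p - cos p * sin (a * p))"
    unfolding sd cd by (simp add: algebra_simps power2_eq_square)
  also have "\<dots> = (sin p - ell' p * cos p) * ((1 - a) * sin (a * p) * sin p)"
    unfolding L[symmetric] by (simp add: algebra_simps power2_eq_square)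
  finally have E: "sin p - ell' p * cos p = V * E p"
    using k by simp
  have "V * (cos (b * p) - E p * sin (b * p)) = V * cos (b * p) - (V * E p) * sin (b * p)"
    by (simp add: right_diff_distrib)
  also have "\<dots> = ell' p * sin ((b + 1) * p) + cos ((b + 1) * p)"
    unfolding E[symmetric] unfolding V[symmetric] by (simp add: distrib_right sin_add cos_add algebra_simps)
  finally have *: "ell' p * sin ((b + 1) * p) + cos ((b + 1) * p) = V * (cos (b * p) - E p * sin (b * p))" ..
  have "cos (b * p) - E p * sin (b * p) = sqrt (1 + (E p)^2) * cos (phase b p)"
  proof -
    have "sqrt (1 + (E p)^2) \<noteq> 0" using sum_power2_eq_zero_iff[of 1 "E p"] by auto
    then show ?thesis
      by (simp add: phase_def cos_add cos_arctan sin_arctan right_diff_distrib)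
  qed
  then show "w b p = ?v * cos (phase b p)"
    unfolding w_def * by (simp only: mult_ac)
qed

text \<open>Logarithmic differentiation gives
  \<open>A' / A = a * ell' + (1 - a) * cot ((1 - a) * p) - cot p\<close>, and the last two terms
  make up \<open>a * E p\<close>.\<close>

lemma A_deriv:
  assumes "0 < p" "p < pi"
  shows "\<exists>d>0. (A has_real_derivative d) (at p)"
proof -
  note s = sin_pos[OF assms]
  have k: "1 - a \<noteq> 0" "a \<noteq> 0" "sin p \<noteq> 0" "sin (a * p) \<noteq> 0" "sin ((1 - a) * p) \<noteq> 0" using s a by auto
  have "(A has_real_derivative
     ((exp (a * ell p) * (a * ell' p) * sin ((1 - a) * p) + exp (a * ell p) * (cos ((1 - a) * p) * (1 - a))) * sin p
      - exp (a * ell p) * sin ((1 - a) * p) * cos p) / (sin p * sin p)) (at p)"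
    unfolding A_def
    using s by (auto intro!: derivative_eq_intros ell_deriv assms)
  also have "((exp (a * ell p) * (a * ell' p) * sin ((1 - a) * p) + exp (a * ell p) * (cos ((1 - a) * p) * (1 - a))) * sin p
      - exp (a * ell p) * sin ((1 - a) * p) * cos p) / (sin p * sin p) = A p * a * (ell' p + E p)"
    unfolding A_def E_def cot_def using k by (simp add: divide_simps; simp add: algebra_simps)
  finally have "(A has_real_derivative A p * a * (ell' p + E p)) (at p)" .
  moreover have "0 < A p" using s a by (simp add: A_def)
  then have "0 < A p * a * (ell' p + E p)"
    using a ell'_pos[OF assms] E_pos[OF assms] by (intro mult_pos_pos) auto
  ultimately show ?thesis by blast
qed

lemma A_strict_mono:
  assumes "0 < p" "p < q" "q < pi"
  shows "A p < A q"
  using A_deriv assms by (intro DERIV_pos_imp_increasing[OF assms(2)]) (meson less_le_trans le_less_trans)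

text \<open>The limit of \<open>A p\<close> as \<open>p\<close> tends to 0. It becomes the
  exponential decay rate in the variable \<open>X\<close>.\<close>

definition A0 :: real where "A0 = exp (a * (ln a / (1 - a))) * (1 - a)"

lemma A0_pos: "0 < A0" using a by (simp add: A0_def)

lemma ell_ge:
  assumes "0 < p" "p < pi"
  shows "ln a / (1 - a) \<le> ell p"
proof -
  have "a \<le> sin (a * p) / sin p"
    using sin_pos[OF assms] sin_mult_concave[of a p] a assms by (simp add: field_simps)
  then show ?thesis using a by (simp add: ell_def divide_right_mono)
qed

lemma A_ge:
  assumes "0 < p" "p < pi"
  shows "A0 \<le> A p"
proof -
  have "1 - a \<le> sin ((1 - a) * p) / sin p"
    using sin_pos[OF assms] sin_mult_concave[of "1 - a" p] a assms by (simp add: field_simps)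
  then have "A0 \<le> exp (a * ell p) * (sin ((1 - a) * p) / sin p)"
    unfolding A0_def using a mult_left_mono[OF ell_ge[OF assms], of a] by (intro mult_mono) auto
  then show ?thesis by (simp add: A_def)
qed

text \<open>As \<open>p\<close> tends to pi, \<open>sin p\<close> tends to 0 from above while
  \<open>sin (a * p)\<close> stays away from 0. The curve thus runs off to infinity along the upper
  side of the negative axis.\<close>

lemma ell_at_pi: "filterlim ell at_top (at_left pi)"
proof -
  have "((\<lambda>p. sin (a * p)) \<longlongrightarrow> sin (a * pi)) (at_left pi)" by (intro tendsto_intros)
  moreover have "0 < sin (a * pi)" using a by (intro sin_gt_zero) auto
  moreover have "filterlim sin (at_right (0::real)) (at_left pi)"
    unfolding filterlim_at
  proof
    show "(sin \<longlongrightarrow> (0::real)) (at_left pi)" using tendsto_sin[OF tendsto_ident_at, of pi] by simp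
    show "eventually (\<lambda>p. sin p \<in> {0<..} \<and> sin p \<noteq> (0::real)) (at_left pi)"
      by (rule eventually_mono[OF eventually_at_left_real[of 0 pi]]) (use sin_pos in force)+
  qed
  ultimately have "filterlim (\<lambda>p. sin (a * p) / sin p) at_top (at_left pi)"
    by (rule filterlim_tendsto_pos_mult_at_top[OF _ _ filterlim_compose[OF filterlim_inverse_at_top_right],
        unfolded divide_inverse[symmetric]])
  then have "filterlim (\<lambda>p. ln (sin (a * p) / sin p)) at_top (at_left pi)"
    by (rule filterlim_compose[OF ln_at_top])
  then have "filterlim (\<lambda>p. (1 / (1 - a)) * ln (sin (a * p) / sin p)) at_top (at_left pi)"
    using a by (intro filterlim_tendsto_pos_mult_at_top[OF tendsto_const]) auto
  then show ?thesis by (simp add: ell_def[abs_def])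
qed

end

section \<open>The ray integral of the Wright function\<close>


lemma has_bochner_integral_Gamma:
  fixes s :: real
  assumes "0 < s"
  shows "has_bochner_integral lborel (\<lambda>t. t powr (s - 1) * exp (- t) * indicator {0<..} t) (Gamma s)"
proof (rule has_bochner_integral_nn_integral)
  have "ennreal (Gamma s) = (\<integral>\<^sup>+t. ennreal (indicator {0..} t * t powr (s - 1) / exp t) \<partial>lborel)"
    using Gamma_conv_nn_integral_real[OF assms] by simp
  also have "\<dots> = (\<integral>\<^sup>+t. ennreal (t powr (s - 1) * exp (- t) * indicator {0<..} t) \<partial>lborel)"
  proof (rule nn_integral_cong_AE)
    have "AE t in lborel. t \<noteq> (0::real)" by (rule AE_lborel_singleton)
    then show "AE t in lborel. ennreal (indicator {0..} t * t powr (s - 1) / exp t)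
        = ennreal (t powr (s - 1) * exp (- t) * indicator {0<..} t)"
      by eventually_elim (auto simp: indicator_def exp_minus field_simps)
  qed
  finally show "(\<integral>\<^sup>+t. ennreal (t powr (s - 1) * exp (- t) * indicator {0<..} t) \<partial>lborel) = ennreal (Gamma s)" ..
qed (use assms in \<open>auto simp: less_imp_le\<close>)

text \<open>Half of the exponent is given away to absorb a factor \<open>exp (|x| t^a)\<close>; the
  other half still ensures integrability, by rescaling the Gamma integral.\<close>

lemma integrable_powr_exp_half:
  fixes s :: real
  assumes "0 < s"
  shows "integrable lborel (\<lambda>t. t powr (s - 1) * exp (- t / 2) * indicator {0<..} t)"
proof -
  have "integrable lborel (\<lambda>t. (2 powr (s - 1)) * ((t / 2) powr (s - 1) * exp (- (t / 2)) * indicator {0<..} (t / 2)))"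
    using lborel_integrable_real_affine[of "\<lambda>t. t powr (s - 1) * exp (- t) * indicator {0<..} t" "1/2" 0]
      has_bochner_integral_Gamma[OF assms]
    by (intro integrable_mult_right) (auto simp: has_bochner_integral_iff)
  also have "(\<lambda>t. (2 powr (s - 1)) * ((t / 2) powr (s - 1) * exp (- (t / 2)) * indicator {0<..} (t / 2)))
      = (\<lambda>t. t powr (s - 1) * exp (- t / 2) * indicator {0<..} t)"
    by (auto simp: fun_eq_iff indicator_def powr_divide)
  finally show ?thesis .
qed

text \<open>The mean value inequality on a vertical segment. In the coordinate
  \<open>s = exp z\<close> the segment is a circular arc, and this is the usual length times maximum
  estimate.\<close>

lemma DERIV_imp_vertical_bound:
  fixes \<Psi> :: "complex \<Rightarrow> complex"
  assumes der: "\<And>z. (\<Psi> has_field_derivative h z) (at z)"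
    and "p \<le> q" and bound: "\<And>t. p \<le> t \<Longrightarrow> t \<le> q \<Longrightarrow> norm (h (Complex y t)) \<le> B"
  shows "\<bar>Im (\<Psi> (Complex y q)) - Im (\<Psi> (Complex y p))\<bar> \<le> B * (q - p)"
proof -
  let ?S = "{z. Re z = y \<and> p \<le> Im z \<and> Im z \<le> q}"
  have "norm (\<Psi> (Complex y q) - \<Psi> (Complex y p)) \<le> B * norm (Complex y q - Complex y p)"
  proof (rule field_differentiable_bound[where S = ?S and f' = h])
    have "?S = ({z. Re z \<le> y} \<inter> {z. Re z \<ge> y}) \<inter> ({z. Im z \<ge> p} \<inter> {z. Im z \<le> q})" by auto
    then show "convex ?S"
      by (simp only: convex_Int convex_halfspace_Im_ge convex_halfspace_Im_le
          convex_halfspace_Re_ge convex_halfspace_Re_le)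
    fix z assume "z \<in> ?S"
    then show "norm (h z) \<le> B" using bound[of "Im z"] by (metis (mono_tags, lifting) complex_surj mem_Collect_eq)
    show "(\<Psi> has_field_derivative h z) (at z within ?S)" by (rule DERIV_subset[OF der]) simp
  qed (use \<open>p \<le> q\<close> in auto)
  moreover have "norm (Complex y q - Complex y p) = q - p"
    using \<open>p \<le> q\<close> by (simp add: cmod_def)
  moreover have "\<bar>Im (\<Psi> (Complex y q)) - Im (\<Psi> (Complex y p))\<bar> \<le> norm (\<Psi> (Complex y q) - \<Psi> (Complex y p))"
    using abs_Im_le_cmod[of "\<Psi> (Complex y q) - \<Psi> (Complex y p)"] by simp
  ultimately show ?thesis by simp
qed

context wright_index
begin

text \<open>Since \<open>a < 1\<close>, the quotient of \<open>t powr a\<close> by \<open>t\<close>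
  tends to 0. Beyond some \<open>K\<close> the left side is at most \<open>t / 2\<close>, and below
  \<open>K\<close> it is bounded.\<close>

lemma powr_le_half_linear: "\<exists>C\<ge>0. \<forall>t>0. x * t powr a \<le> t / 2 + C"
proof -
  have "((\<lambda>t. \<bar>x\<bar> * t powr (a - 1)) \<longlongrightarrow> \<bar>x\<bar> * 0) at_top"
    using a by (intro tendsto_intros tendsto_neg_powr filterlim_ident) auto
  then have "eventually (\<lambda>t. \<bar>x\<bar> * t powr (a - 1) < 1 / 2) at_top"
    by (rule order_tendstoD) simp
  then obtain K where K: "\<And>t. t \<ge> K \<Longrightarrow> \<bar>x\<bar> * t powr (a - 1) < 1 / 2"
    by (auto simp: eventually_at_top_linorder)
  have "x * t powr a \<le> t / 2 + \<bar>x\<bar> * \<bar>K\<bar> powr a" if "t > 0" for t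
  proof (cases "t \<ge> K")
    case True
    have "x * t powr a \<le> \<bar>x\<bar> * t powr a" by (intro mult_right_mono) auto
    also have "\<dots> = t * (\<bar>x\<bar> * t powr (a - 1))"
      using that by (simp add: powr_diff)
    also have "\<dots> \<le> t * (1 / 2)" using K[OF True] that by (intro mult_left_mono) auto
    finally have "x * t powr a \<le> t / 2" by simp
    then show ?thesis by (smt (verit) mult_nonneg_nonneg powr_ge_zero abs_ge_zero)
  next
    case False
    have "x * t powr a \<le> \<bar>x\<bar> * t powr a" by (intro mult_right_mono) auto
    also have "\<dots> \<le> \<bar>x\<bar> * \<bar>K\<bar> powr a"
      using False that a by (intro mult_left_mono powr_mono2) auto
    finally show ?thesis using that by simp
  qed
  then show ?thesis by (intro exI[of _ "\<bar>x\<bar> * \<bar>K\<bar> powr a"]) auto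
qed

text \<open>In the notation of the Wright function, \<open>F b x = \<phi>(-a, -b, -x)\<close>.\<close>
definition F :: "real \<Rightarrow> real \<Rightarrow> real" where
  "F b x = (\<Sum>n. (- x) ^ n / fact n * rGamma (- b - a * n))"

text \<open>The imaginary part of the Hankel integrand \<open>s^b exp (s - x s^a) ds\<close> on the
  ray \<open>s = t e^(i pi)\<close>; \<open>ds\<close> supplies the \<open>+ 1\<close> in the first
  argument.\<close>

definition ray :: "real \<Rightarrow> real \<Rightarrow> real \<Rightarrow> real" where
  "ray b x t = t powr b * exp (- t) * Im (cis (pi * (b + 1)) * exp (- (x * t powr a) * cis (pi * a)))"

text \<open>Euler's reflection formula. It turns each coefficient of the series into a Gamma
  integral times a sine, which is the imaginary part of a \<open>cis\<close>.\<close>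

lemma rGamma_eq_Gamma_sin:
  assumes "-1 < s"
  shows "pi * rGamma (- s) = Gamma (s + 1) * sin (pi * (s + 1))"
proof -
  have "complex_of_real (rGamma (- s) * rGamma (s + 1)) = complex_of_real (sin (pi * (- s)) / pi)"
    using rGamma_reflection_complex[of "complex_of_real (- s)"] rGamma_complex_of_real[of "-s"]
      rGamma_complex_of_real[of "s + 1"] sin_of_real[of "pi * s", where 'a = complex]
    by (simp add: add_ac)
  then have "rGamma (- s) * rGamma (s + 1) = sin (pi * (- s)) / pi"
    by (simp only: of_real_eq_iff)
  moreover have "Gamma (s + 1) > 0" using assms by simp
  then have "rGamma (s + 1) * Gamma (s + 1) = 1" by (simp add: rGamma_inverse_Gamma)
  then have "pi * rGamma (- s) = pi * (rGamma (- s) * rGamma (s + 1)) * Gamma (s + 1)"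
    by (simp add: mult.assoc)
  ultimately have "pi * rGamma (- s) = sin (pi * (- s)) * Gamma (s + 1)"
    by simp
  then show ?thesis by (simp add: distrib_left sin_add)
qed

lemma ray_dominated:
  assumes "-1 < b"
  obtains W where "integrable lborel W"
    "\<And>t. 0 < t \<Longrightarrow> t powr b * exp (- t) * exp (\<bar>x\<bar> * t powr a) \<le> W t"
    "\<And>t. 0 \<le> W t"
proof -
  obtain C where C: "C \<ge> 0" "\<And>t. 0 < t \<Longrightarrow> \<bar>x\<bar> * t powr a \<le> t / 2 + C"
    using powr_le_half_linear by blast
  let ?W = "\<lambda>t. exp C * (t powr (b + 1 - 1) * exp (- t / 2) * indicator {0<..} t)"
  show ?thesis
  proof
    show "integrable lborel ?W"
      using integrable_powr_exp_half[of "b + 1"] assms by (intro integrable_mult_right) auto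
    fix t :: real
    show "0 \<le> ?W t" by simp
    assume t: "0 < t"
    have "exp (- t) * exp (\<bar>x\<bar> * t powr a) \<le> exp C * exp (- t / 2)"
      unfolding exp_add[symmetric] using C(2)[OF t] by simp
    then have "t powr b * (exp (- t) * exp (\<bar>x\<bar> * t powr a)) \<le> t powr b * (exp C * exp (- t / 2))"
      by (rule mult_left_mono) simp
    then show "t powr b * exp (- t) * exp (\<bar>x\<bar> * t powr a) \<le> ?W t"
      using t by (simp add: mult_ac)
  qed
qed

lemma ray_term:
  fixes n :: nat
  assumes "0 < t"
  shows "t powr b * exp (- t) * Im (cis (pi * (b + 1)) * ((- (x * t powr a) * cis (pi * a)) ^ n /\<^sub>R fact n))
    = (- x) ^ n / fact n * sin (pi * (b + a * n + 1)) * (t powr (b + a * n) * exp (- t))"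
proof -
  have "(- (x * t powr a) * cis (pi * a)) ^ n = of_real ((- x) ^ n * t powr (a * n)) * cis (real n * (pi * a))"
  proof -
    have "- (x * t powr a) * cis (pi * a) = of_real (- x * t powr a) * cis (pi * a)" by simp
    moreover have "(- x * t powr a) ^ n = (- x) ^ n * t powr (a * n)"
      using assms by (simp only: power_mult_distrib powr_powr[symmetric]) (simp add: powr_realpow)
    ultimately show ?thesis
      by (simp only: power_mult_distrib Complex.DeMoivre of_real_power[symmetric])
  qed
  moreover have "cis (pi * (b + 1)) * cis (real n * (pi * a)) = cis (pi * (b + a * n + 1))"
    unfolding cis_mult by (simp add: algebra_simps)
  moreover have Im_cis: "Im (of_real r * cis q) = r * sin q" for r q by simp
  moreover define c where "c = (- x) ^ n * t powr (a * n)"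
  ultimately have "cis (pi * (b + 1)) * ((- (x * t powr a) * cis (pi * a)) ^ n /\<^sub>R fact n)
     = of_real (c / fact n) * cis (pi * (b + a * n + 1))"
    by (simp add: scaleR_conv_of_real field_simps)
  then have "Im (cis (pi * (b + 1)) * ((- (x * t powr a) * cis (pi * a)) ^ n /\<^sub>R fact n))
     = c / fact n * sin (pi * (b + a * n + 1))"
    by (simp only: Im_cis)
  then show ?thesis
    unfolding c_def by (simp add: powr_add mult_ac)
qed

text \<open>Expand the exponential in \<open>ray\<close> and integrate term by term. All partial
  sums of the exponential series are bounded by \<open>exp (|x| t^a)\<close>, so the majorant
  \<open>W\<close> allows dominated convergence.\<close>

lemma wright_ray_integral:
  assumes "-1 < b"
  shows "(\<lambda>n. pi * ((- x) ^ n / fact n * rGamma (- b - a * n))) sums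
           (\<integral>t. ray b x t * indicator {0<..} t \<partial>lborel)"
    and "integrable lborel (\<lambda>t. ray b x t * indicator {0<..} t)"
proof -
  obtain W where W: "integrable lborel W"
    "\<And>t. 0 < t \<Longrightarrow> t powr b * exp (- t) * exp (\<bar>x\<bar> * t powr a) \<le> W t" "\<And>t. 0 \<le> W t"
    using ray_dominated[OF assms] by metis
  let ?f = "\<lambda>(n::nat) t. (- x) ^ n / fact n * sin (pi * (b + a * n + 1)) * (t powr (b + a * n) * exp (- t) * indicator {0<..} t)"
  have int: "has_bochner_integral lborel (?f n) (pi * ((- x) ^ n / fact n * rGamma (- b - a * n)))" for n
  proof -
    have bn: "-1 < b + a * n" using assms a by (smt (verit) mult_nonneg_nonneg of_nat_0_le_iff)
    have "has_bochner_integral lborel (?f n) ((- x) ^ n / fact n * sin (pi * (b + a * n + 1)) * Gamma (b + a * n + 1))"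
      using has_bochner_integral_Gamma[of "b + a * n + 1"] bn
      by (intro has_bochner_integral_mult_right) auto
    also have "(- x) ^ n / fact n * sin (pi * (b + a * n + 1)) * Gamma (b + a * n + 1)
        = (- x) ^ n / fact n * (Gamma (b + a * n + 1) * sin (pi * (b + a * n + 1)))"
      by (simp only: mult_ac)
    also have "\<dots> = pi * ((- x) ^ n / fact n * rGamma (- b - a * n))"
      unfolding rGamma_eq_Gamma_sin[OF bn, symmetric] by simp
    finally show ?thesis .
  qed
  let ?z = "\<lambda>t. - (x * t powr a) * cis (pi * a)"
  have *: "(\<Sum>n<N. ?f n t) = t powr b * exp (- t) * Im (cis (pi * (b + 1)) * (\<Sum>n<N. (?z t) ^ n /\<^sub>R fact n))"
    if "0 < t" for t N
  proof -
    have "(\<Sum>n<N. ?f n t) = (\<Sum>n<N. t powr b * exp (- t) * Im (cis (pi * (b + 1)) * ((?z t) ^ n /\<^sub>R fact n)))"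
      by (rule sum.cong[OF refl], subst ray_term[OF that]) (use that in simp)
    then show ?thesis by (simp only: sum_distrib_left[symmetric] Im_sum[symmetric])
  qed
  have lim: "(\<lambda>N. \<Sum>n<N. ?f n t) \<longlonglongrightarrow> ray b x t * indicator {0<..} t" for t
  proof (cases "0 < t")
    case True
    have "(\<lambda>N. \<Sum>n<N. (?z t) ^ n /\<^sub>R fact n) \<longlonglongrightarrow> exp (?z t)"
      using exp_converges[of "?z t"] by (simp add: sums_def)
    then have "(\<lambda>N. t powr b * exp (- t) * Im (cis (pi * (b + 1)) * (\<Sum>n<N. (?z t) ^ n /\<^sub>R fact n)))
       \<longlonglongrightarrow> t powr b * exp (- t) * Im (cis (pi * (b + 1)) * exp (?z t))"
      by (intro tendsto_intros)
    then show ?thesis using True by (simp only: *[OF True] ray_def) simp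
  qed simp
  have bd: "norm (\<Sum>n<N. ?f n t) \<le> W t" for t N
  proof (cases "0 < t")
    case True
    have "norm (\<Sum>n<N. ?f n t) = t powr b * exp (- t) * \<bar>Im (cis (pi * (b + 1)) * (\<Sum>n<N. (?z t) ^ n /\<^sub>R fact n))\<bar>"
      unfolding *[OF True] by (simp add: abs_mult)
    also have "\<dots> \<le> t powr b * exp (- t) * exp (\<bar>x\<bar> * t powr a)"
    proof (rule mult_left_mono)
      have "\<bar>Im (cis (pi * (b + 1)) * (\<Sum>n<N. (?z t) ^ n /\<^sub>R fact n))\<bar> \<le> norm (\<Sum>n<N. (?z t) ^ n /\<^sub>R fact n)"
        by (rule order_trans[OF abs_Im_le_cmod]) (simp add: norm_mult)
      also have "\<dots> \<le> (\<Sum>n<N. (norm (?z t)) ^ n /\<^sub>R fact n)"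
        by (rule order_trans[OF norm_sum]) (simp add: norm_power)
      also have "\<dots> \<le> exp (norm (?z t))"
        unfolding exp_def by (intro sum_le_suminf summable_exp_generic) auto
      also have "norm (?z t) = \<bar>x\<bar> * t powr a" by (simp add: norm_mult abs_mult)
      finally show "\<bar>Im (cis (pi * (b + 1)) * (\<Sum>n<N. (?z t) ^ n /\<^sub>R fact n))\<bar> \<le> exp (\<bar>x\<bar> * t powr a)" .
    qed simp
    finally show ?thesis using W(2)[OF True] by simp
  qed (simp add: W)
  have intS: "has_bochner_integral lborel (\<lambda>t. \<Sum>n<N. ?f n t) (\<Sum>n<N. pi * ((- x) ^ n / fact n * rGamma (- b - a * n)))" for N
    by (rule has_bochner_integral_sum) (rule int)
  then have measS: "(\<lambda>t. \<Sum>n<N. ?f n t) \<in> borel_measurable lborel" for N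
    by (rule borel_measurable_has_bochner_integral)
  have meas: "(\<lambda>t. ray b x t * indicator {0<..} t) \<in> borel_measurable lborel"
    by (rule borel_measurable_LIMSEQ_real[OF lim]) (rule measS)
  show "integrable lborel (\<lambda>t. ray b x t * indicator {0<..} t)"
    by (rule integrable_dominated_convergence[OF meas measS W(1)]; rule AE_I2, rule lim bd)
  have "(\<lambda>N. \<integral>t. (\<Sum>n<N. ?f n t) \<partial>lborel) \<longlonglongrightarrow> (\<integral>t. ray b x t * indicator {0<..} t \<partial>lborel)"
    by (rule integral_dominated_convergence[OF meas measS W(1)]; rule AE_I2, rule lim bd)
  then show "(\<lambda>n. pi * ((- x) ^ n / fact n * rGamma (- b - a * n))) sums
           (\<integral>t. ray b x t * indicator {0<..} t \<partial>lborel)"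
    unfolding sums_def has_bochner_integral_integral_eq[OF intS] .
qed

lemma F_sums:
  assumes "-1 < b"
  shows "(\<lambda>n. (- x) ^ n / fact n * rGamma (- b - a * n)) sums F b x"
    and "pi * F b x = (\<integral>t. ray b x t * indicator {0<..} t \<partial>lborel)"
proof -
  \<comment> \<open>\<open>F\<close> is a bare \<open>suminf\<close>; the convergence of its series
    is read off from the termwise integration.\<close>
  have "summable (\<lambda>n. pi * ((- x) ^ n / fact n * rGamma (- b - a * n)))"
    using wright_ray_integral(1)[OF assms] by (rule sums_summable)
  then have s: "summable (\<lambda>n. (- x) ^ n / fact n * rGamma (- b - a * n))"
    by (subst (asm) summable_cmult_iff) simp
  then show "(\<lambda>n. (- x) ^ n / fact n * rGamma (- b - a * n)) sums F b x"
    unfolding F_def by (rule summable_sums)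
  then have "(\<lambda>n. pi * ((- x) ^ n / fact n * rGamma (- b - a * n))) sums (pi * F b x)"
    by (rule sums_mult)
  then show "pi * F b x = (\<integral>t. ray b x t * indicator {0<..} t \<partial>lborel)"
    using wright_ray_integral(1)[OF assms] by (rule sums_unique2)
qed

end

section \<open>Deformation to the steepest descent curve\<close>


lemma DERIV_Im_path:
  fixes \<Psi> :: "complex \<Rightarrow> complex"
  assumes "(\<Psi> has_field_derivative d) (at (Complex (u t) (v t)))"
    and u: "(u has_real_derivative u') (at t)" and v: "(v has_real_derivative v') (at t)"
  shows "((\<lambda>t. Im (\<Psi> (Complex (u t) (v t)))) has_real_derivative Im (d * Complex u' v')) (at t)"
proof -
  have "((\<lambda>t. of_real (u t) + \<i> * of_real (v t)) has_vector_derivative (of_real u' + \<i> * of_real v')) (at t)"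
    using u v by (intro has_vector_derivative_add has_vector_derivative_mult_right has_vector_derivative_of_real)
      (simp_all add: has_real_derivative_iff_has_vector_derivative)
  then have "((\<lambda>t. Complex (u t) (v t)) has_vector_derivative Complex u' v') (at t)"
    by (simp only: Complex_eq)
  from field_vector_diff_chain_at[OF this assms(1)]
  have "((\<lambda>t. \<Psi> (Complex (u t) (v t))) has_vector_derivative Complex u' v' * d) (at t)"
    by (simp add: o_def)
  from bounded_linear.has_vector_derivative[OF bounded_linear_Im this]
  show ?thesis
    by (simp add: has_real_derivative_iff_has_vector_derivative mult.commute)
qed

context wright_index
begin

text \<open>In the logarithmic coordinate \<open>s = exp z\<close> the Hankel integrand of the Wright function becomes
  the entire function \<open>h b x\<close>, so no branch cut has to be avoided.\<close>
definition h :: "real \<Rightarrow> real \<Rightarrow> complex \<Rightarrow> complex" where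
  "h b x z = exp (of_real (b + 1) * z + exp z - of_real x * exp (of_real a * z))"

lemma h_Complex:
  "h b x (Complex y p) =
     of_real (exp ((b + 1) * y + exp y * cos p - x * (exp (a * y) * cos (a * p))))
       * cis ((b + 1) * p + exp y * sin p - x * (exp (a * y) * sin (a * p)))"
  unfolding h_def by (subst exp_eq_polar) (simp add: Re_exp Im_exp)

text \<open>\<open>h\<close> is entire, hence has a primitive. It is real on the real axis, so the
  imaginary part of the primitive is constant there and can be normalised to 0.\<close>

lemma h_primitive:
  obtains \<Psi> where "\<And>z. (\<Psi> has_field_derivative h b x z) (at z)" "\<And>y. Im (\<Psi> (Complex y 0)) = 0"
proof -
  have "h b x holomorphic_on UNIV"
    unfolding h_def by (intro holomorphic_intros)
  then obtain g where g: "\<And>z. (g has_field_derivative h b x z) (at z)"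
    using holomorphic_convex_primitive'[of UNIV "h b x"] by auto
  have "((\<lambda>y. Im (g (Complex y 0))) has_real_derivative 0) (at y)" for y
  proof -
    have "((\<lambda>y. Im (g (Complex y 0))) has_real_derivative Im (h b x (Complex y 0) * Complex 1 0)) (at y)"
      by (rule DERIV_Im_path[OF g]) (auto intro!: derivative_eq_intros)
    then show ?thesis by (simp add: h_Complex)
  qed
  then have const: "Im (g (Complex y 0)) = Im (g (Complex 0 0))" for y
    by (intro DERIV_isconst_all allI)
  show ?thesis
  proof (rule that[of "\<lambda>z. g z - g (Complex 0 0)"])
    show "((\<lambda>z. g z - g (Complex 0 0)) has_field_derivative h b x z) (at z)" for z
      using DERIV_diff[OF g DERIV_const[of "g (Complex 0 0)"]] by simp
    show "Im (g (Complex y 0) - g (Complex 0 0)) = 0" for y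
      using const[of y] by simp
  qed
qed

text \<open>The first bound is crude and serves near the real axis and for \<open>y\<close> tending
  to minus infinity. Near the negative axis of \<open>s\<close> the term \<open>- exp y / 2\<close>
  of the second bound beats \<open>x * exp (a * y)\<close> because \<open>a < 1\<close>, so distant
  arcs contribute nothing.\<close>

lemma norm_h_le:
  assumes "0 < x"
  shows "norm (h b x (Complex y p)) \<le> exp ((b + 1) * y + exp y + x * exp (a * y))"
    and "cos p \<le> -1/2 \<Longrightarrow> norm (h b x (Complex y p)) \<le> exp ((b + 1) * y - exp y / 2 + x * exp (a * y))"
proof -
  have n: "norm (h b x (Complex y p)) = exp ((b + 1) * y + exp y * cos p - x * (exp (a * y) * cos (a * p)))"
    by (simp add: h_Complex norm_mult)
  have "x * (exp (a * y) * - cos (a * p)) \<le> x * (exp (a * y) * 1)"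
    using assms by (intro mult_left_mono) auto
  moreover have "exp y * cos p \<le> exp y" by simp
  ultimately show "norm (h b x (Complex y p)) \<le> exp ((b + 1) * y + exp y + x * exp (a * y))"
    unfolding n exp_le_cancel_iff by linarith
  assume "cos p \<le> -1/2"
  then have "exp y * cos p \<le> exp y * (-1/2)" by (intro mult_left_mono) auto
  with \<open>x * (exp (a * y) * - cos (a * p)) \<le> _\<close>
  show "norm (h b x (Complex y p)) \<le> exp ((b + 1) * y - exp y / 2 + x * exp (a * y))"
    unfolding n exp_le_cancel_iff by linarith
qed

lemma Im_primitive_le:
  assumes "0 < x" "0 \<le> p"
    and "\<And>z. (\<Psi> has_field_derivative h b x z) (at z)" "\<And>y. Im (\<Psi> (Complex y 0)) = 0"
  shows "\<bar>Im (\<Psi> (Complex y p))\<bar> \<le> exp ((b + 1) * y + exp y + x * exp (a * y)) * p"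
  using DERIV_imp_vertical_bound[of \<Psi> "h b x" 0 p y, OF assms(3,2) norm_h_le(1)[OF assms(1)]] assms(4)
  by simp

lemma ray_real:
  "ray b x t = t powr b * exp (- t) * exp (- (x * t powr a * cos (pi * a)))
     * sin (pi * (b + 1) - x * t powr a * sin (pi * a))"
proof -
  have "exp (- (x * t powr a) * cis (pi * a)) =
      of_real (exp (- (x * t powr a * cos (pi * a)))) * cis (- (x * t powr a * sin (pi * a)))"
    by (subst exp_eq_polar) simp
  then have "cis (pi * (b + 1)) * exp (- (x * t powr a) * cis (pi * a)) =
      of_real (exp (- (x * t powr a * cos (pi * a)))) * cis (pi * (b + 1) - x * t powr a * sin (pi * a))"
    by (simp only: mult.left_commute) (simp add: cis_mult)
  then show ?thesis
    by (simp add: ray_def)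
qed

lemma ray_eq_h:
  assumes "0 < t"
  shows "Im (h b x (Complex (ln t) pi) * Complex (1 / t) 0) = ray b x t"
proof -
  have "exp ((b + 1) * ln t + - t - x * (exp (a * ln t) * cos (a * pi)))
      = exp ((b + 1) * ln t) * exp (- t) * exp (- (x * t powr a * cos (pi * a)))"
    unfolding exp_add[symmetric] using assms by (simp add: powr_def mult_ac)
  also have "exp ((b + 1) * ln t) = t * t powr b"
    using assms by (simp add: powr_def distrib_right exp_add)
  finally show ?thesis
    using assms by (simp add: h_Complex ray_real powr_def mult_ac)
qed

text \<open>Along \<open>Complex (ln t) pi\<close> the imaginary part of the primitive has
  derivative \<open>ray b x t\<close>. The fundamental theorem on \<open>[1/T, T]\<close> and
  dominated convergence give \<open>pi * F b x\<close> for the total increment, and the lower end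
  tends to 0 by the crude bound.\<close>

lemma Im_primitive_at_top:
  assumes b: "-1 < b" and x: "0 < x"
    and \<Psi>: "\<And>z. (\<Psi> has_field_derivative h b x z) (at z)" "\<And>y. Im (\<Psi> (Complex y 0)) = 0"
  shows "((\<lambda>y. Im (\<Psi> (Complex y pi))) \<longlongrightarrow> pi * F b x) at_top"
proof -
  let ?G = "\<lambda>t. Im (\<Psi> (Complex (ln t) pi))"
  have G: "(?G has_real_derivative ray b x t) (at t)" if "0 < t" for t
    unfolding ray_eq_h[OF that, symmetric]
    by (rule DERIV_Im_path[OF \<Psi>(1)]) (use that in \<open>auto intro!: derivative_eq_intros\<close>)
  define c where "c = b + 1"
  have "0 < c" using b by (simp add: c_def)
  then have "((\<lambda>y. exp (c * y + exp y + x * exp (a * y)) * pi) \<longlongrightarrow> 0) at_bot"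
    using a x by real_asymp
  then have bot: "((\<lambda>y. Im (\<Psi> (Complex y pi))) \<longlongrightarrow> 0) at_bot"
    by (rule Lim_null_comparison[rotated]) (use Im_primitive_le[OF x _ \<Psi>] in \<open>auto simp: c_def\<close>)
  have FTC: "(\<integral>t. ray b x t * indicator {1 / T..T} t \<partial>lborel) = ?G T - ?G (1 / T)" if "1 \<le> T" for T
  proof (rule integral_FTC_Icc_real)
    have "1 / T \<le> 1" using that by simp
    then show "1 / T \<le> T" using that by linarith
    fix t assume "1 / T \<le> t"
    then have t: "0 < t" using that by (smt (verit) divide_pos_pos)
    show "DERIV ?G t :> ray b x t" by (rule G[OF t])
    show "isCont (ray b x) t"
      unfolding ray_real[abs_def] using t by (intro continuous_intros) auto
  qed
  have "((\<lambda>T. \<integral>t. ray b x t * indicator {1 / T..T} t \<partial>lborel) \<longlongrightarrow> (\<integral>t. ray b x t * indicator {0<..} t \<partial>lborel)) at_top"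
  proof (rule integral_dominated_convergence_at_top)
    note int = wright_ray_integral(2)[OF b, of x]
    show "integrable lborel (\<lambda>t. norm (ray b x t * indicator {0<..} t))"
      using int by (rule integrable_norm)
    show "(\<lambda>t. ray b x t * indicator {0<..} t) \<in> borel_measurable lborel" using int by simp
    show "(\<lambda>t. ray b x t * indicator {1 / T..T} t) \<in> borel_measurable lborel" for T
      unfolding ray_real by measurable
    show "AE t in lborel. ((\<lambda>T. ray b x t * indicator {1 / T..T} t) \<longlongrightarrow> ray b x t * indicator {0<..} t) at_top"
    proof (rule AE_mp[OF AE_lborel_singleton[of 0]], intro AE_I2 impI)
      fix t :: real assume "t \<noteq> 0"
      have "eventually (\<lambda>T. ray b x t * indicator {1 / T..T} t = ray b x t * indicator {0<..} t) at_top"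
      proof (cases "0 < t")
        case True
        show ?thesis
          using eventually_ge_at_top[of "max t (1 / t)"] 
        proof eventually_elim
          case (elim T)
          then have "1 / t \<le> T" "t \<le> T" by auto
          then have "1 / T \<le> t" using \<open>0 < t\<close> by (smt (verit) divide_le_eq divide_pos_pos mult.commute zero_less_divide_1_iff)
          then show ?case using elim True by simp
        qed
      next
        case False
        show ?thesis
          using eventually_gt_at_top[of 0]
        proof eventually_elim
          case (elim T)
          then have "0 < 1 / T" by simp
          then have "\<not> 1 / T \<le> t" using False by linarith
          then show ?case using False by simp
        qed
      qed
      then show "((\<lambda>T. ray b x t * indicator {1 / T..T} t) \<longlongrightarrow> ray b x t * indicator {0<..} t) at_top"
        by (rule tendsto_eventually)
    qed
    show "eventually (\<lambda>T. AE t in lborel. norm (ray b x t * indicator {1 / T..T} t) \<le> norm (ray b x t * indicator {0<..} t)) at_top"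
      using eventually_gt_at_top[of 0]
    proof eventually_elim
      case (elim T)
      then have "0 < 1 / T" by simp
      then have "0 < t" if "1 / T \<le> t" for t using that by linarith
      then show ?case by (intro AE_I2) (auto simp: indicator_def)
    qed
  qed
  then have "((\<lambda>T. ?G T - ?G (1 / T)) \<longlongrightarrow> pi * F b x) at_top"
    unfolding F_sums(2)[OF b]
    by (rule Lim_transform_eventually) (use eventually_ge_at_top[of 1] in eventually_elim, use FTC in simp)
  moreover have "((\<lambda>T. ?G (1 / T)) \<longlongrightarrow> 0) at_top"
  proof (rule filterlim_compose[OF bot])
    show "LIM T at_top. ln (1 / T) :: real :> at_bot" by real_asymp
  qed
  ultimately have "((\<lambda>T. ?G T - ?G (1 / T) + ?G (1 / T)) \<longlongrightarrow> pi * F b x + 0) at_top"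
    by (rule tendsto_add)
  then have "(?G \<longlongrightarrow> pi * F b x) at_top" by simp
  from filterlim_compose[OF this exp_at_top] show ?thesis by simp
qed

text \<open>The equation of the curve: \<open>s\<close> and \<open>s^a\<close> have equal imaginary
  parts. Together with \<open>A_eq\<close> this says \<open>s - s^a = - A p\<close>.\<close>

lemma exp_ell_sin:
  assumes "0 < p" "p < pi"
  shows "exp (ell p) * sin p = exp (a * ell p) * sin (a * p)"
proof -
  have "exp (ell p) = exp (a * ell p) * exp ((1 - a) * ell p)"
    unfolding exp_add[symmetric] by (simp add: algebra_simps)
  then show ?thesis using exp_ell[OF assms] sin_pos[OF assms] by simp
qed

lemma A_eq:
  assumes "0 < p" "p < pi"
  shows "A p = exp (a * ell p) * cos (a * p) - exp (ell p) * cos p"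
proof -
  have "sin ((1 - a) * p) = sin p * cos (a * p) - cos p * sin (a * p)"
    using sin_diff[of p "a * p"] by (simp add: algebra_simps)
  then have "A p * sin p = exp (a * ell p) * (sin p * cos (a * p) - cos p * sin (a * p))"
    using sin_pos[OF assms] by (simp add: A_def)
  also have "\<dots> = exp (a * ell p) * cos (a * p) * sin p - (exp (a * ell p) * sin (a * p)) * cos p"
    by (simp add: algebra_simps)
  also have "\<dots> = (exp (a * ell p) * cos (a * p) - exp (ell p) * cos p) * sin p"
    unfolding exp_ell_sin[OF assms, symmetric] by (simp add: algebra_simps)
  finally show ?thesis using sin_pos[OF assms] by simp
qed

text \<open>For \<open>x = X powr (1 - a)\<close> the exponent is homogeneous: at \<open>X s\<close>
  it equals \<open>X (s - s^a)\<close>, so one curve, scaled by \<open>X\<close>, serves every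
  \<open>x\<close>.\<close>

lemma h_on_curve:
  assumes "0 < X" "0 < p" "p < pi"
  shows "Im (h b (X powr (1 - a)) (Complex (ln X + ell p) p) * Complex (ell' p) 1)
    = X powr (b + 1) * (exp (- X * A p) * w b p)"
proof -
  let ?y = "ln X + ell p"
  have y: "exp ?y = X * exp (ell p)" using assms by (simp add: exp_add)
  have "X powr (1 - a) * exp (a * ?y) = (X powr (1 - a) * X powr a) * exp (a * ell p)"
    using assms by (simp add: distrib_left exp_add powr_def mult_ac)
  also have "\<dots> = X * exp (a * ell p)" using assms by (simp add: powr_add[symmetric])
  finally have ay: "X powr (1 - a) * (exp (a * ?y) * c) = X * (exp (a * ell p) * c)" for c
    by (simp only: mult.assoc[symmetric])
  have "exp ?y * sin p = X powr (1 - a) * (exp (a * ?y) * sin (a * p))"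
    unfolding y ay by (simp add: exp_ell_sin[OF assms(2,3)])
  moreover have "(b + 1) * ?y + exp ?y * cos p - X powr (1 - a) * (exp (a * ?y) * cos (a * p))
      = (b + 1) * ln X + (b + 1) * ell p + (- X * A p)"
    unfolding y ay A_eq[OF assms(2,3)] by (simp add: algebra_simps)
  ultimately have "h b (X powr (1 - a)) (Complex ?y p)
      = of_real (X powr (b + 1) * exp ((b + 1) * ell p) * exp (- X * A p)) * cis ((b + 1) * p)"
    unfolding h_Complex using assms by (simp add: exp_add exp_diff exp_minus divide_inverse powr_def)
  then show ?thesis by (simp add: w_def algebra_simps)
qed

lemma ell_mono:
  assumes "0 < p" "p \<le> q" "q < pi"
  shows "ell p \<le> ell q"
  using assms
  by (intro DERIV_nonneg_imp_nondecreasing[OF assms(2)])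
     (meson ell_deriv ell'_pos less_imp_le less_le_trans le_less_trans)

text \<open>\<open>m\<close> is the imaginary part of a primitive of \<open>h\<close> along the
  scaled curve, divided by \<open>X powr (b + 1)\<close>. It vanishes at the start because the curve
  approaches the real axis while staying bounded to the right. At the other end a vertical segment
  on which \<open>h\<close> becomes negligible leads to the line \<open>Im z = pi\<close>.\<close>

lemma steepest_descent:
  assumes b: "-1 < b" and X: "0 < X"
  obtains m where
    "\<And>p. 0 < p \<Longrightarrow> p < pi \<Longrightarrow> (m has_real_derivative exp (- X * A p) * w b p) (at p)"
    "(m \<longlongrightarrow> 0) (at_right 0)"
    "(m \<longlongrightarrow> X powr - (b + 1) * (pi * F b (X powr (1 - a)))) (at_left pi)"
proof -
  define x where "x = X powr (1 - a)"
  have x: "0 < x" using X by (simp add: x_def)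
  obtain \<Psi> where \<Psi>: "\<And>z. (\<Psi> has_field_derivative h b x z) (at z)" "\<And>y. Im (\<Psi> (Complex y 0)) = 0"
    using h_primitive by metis
  let ?y = "\<lambda>p. ln X + ell p"
  let ?g = "\<lambda>p. Im (\<Psi> (Complex (?y p) p))"
  have g: "(?g has_real_derivative X powr (b + 1) * (exp (- X * A p) * w b p)) (at p)" if "0 < p" "p < pi" for p
    unfolding h_on_curve[OF X that, symmetric]
    by (rule DERIV_Im_path[OF \<Psi>(1)[unfolded x_def]]) (use that in \<open>auto intro!: derivative_eq_intros ell_deriv\<close>)
  have der: "((\<lambda>p. X powr - (b + 1) * ?g p) has_real_derivative exp (- X * A p) * w b p) (at p)" if "0 < p" "p < pi" for p
  proof -
    have "X powr - (b + 1) * X powr (b + 1) = 1" using X by (simp add: powr_add[symmetric] del: minus_add_distrib)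
    then show ?thesis
      using DERIV_cmult[OF g[OF that], of "X powr - (b + 1)"] by (simp only: mult.assoc[symmetric] mult_1_left)
  qed
  have "(?g \<longlongrightarrow> 0) (at_right 0)"
  proof (rule Lim_null_comparison)
    let ?B = "\<lambda>y. exp ((b + 1) * y + exp y + x * exp (a * y))"
    show "eventually (\<lambda>p. norm (?g p) \<le> ?B (?y 1) * p) (at_right 0)"
      using eventually_at_right_real[of 0 1, simplified]
    proof eventually_elim
      case (elim p)
      then have "?y p \<le> ?y 1" using pi_gt3 by (simp add: ell_mono)
      then have "?B (?y p) \<le> ?B (?y 1)"
        using a b x by (simp only: exp_le_cancel_iff) (intro add_mono mult_left_mono, auto)
      then have "?B (?y p) * p \<le> ?B (?y 1) * p" using elim by (intro mult_right_mono) auto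
      moreover have "norm (?g p) \<le> ?B (?y p) * p"
        unfolding real_norm_def using elim by (intro Im_primitive_le[OF x _ \<Psi>]) simp
      ultimately show ?case by (rule order_trans[rotated])
    qed
    show "((\<lambda>p. ?B (?y 1) * p) \<longlongrightarrow> 0) (at_right 0)"
      using tendsto_mult[OF tendsto_const tendsto_ident_at, of "?B (?y 1)" 0 "{0<..}"] by simp
  qed
  then have "((\<lambda>p. X powr - (b + 1) * ?g p) \<longlongrightarrow> X powr - (b + 1) * 0) (at_right 0)"
    by (intro tendsto_intros)
  moreover have y: "filterlim ?y at_top (at_left pi)"
    by (rule filterlim_tendsto_add_at_top[OF tendsto_const ell_at_pi])
  have "((\<lambda>p. ?g p - Im (\<Psi> (Complex (?y p) pi))) \<longlongrightarrow> 0) (at_left pi)"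
  proof (rule Lim_null_comparison)
    let ?B = "\<lambda>y. exp ((b + 1) * y - exp y / 2 + x * exp (a * y)) * pi"
    show "eventually (\<lambda>p. norm (?g p - Im (\<Psi> (Complex (?y p) pi))) \<le> ?B (?y p)) (at_left pi)"
    \<comment> \<open>From \<open>2 * pi / 3\<close> on, cosine is at most -1/2, as the second part
      of \<open>norm_h_le\<close> requires.\<close>
    proof (rule eventually_mono[OF eventually_at_left_real[of "2 * pi / 3" pi]])
      fix p assume p: "p \<in> {2 * pi / 3<..<pi}"
      have "norm (h b x (Complex (?y p) t)) \<le> exp ((b + 1) * ?y p - exp (?y p) / 2 + x * exp (a * ?y p))"
        if "p \<le> t" "t \<le> pi" for t
      proof (rule norm_h_le(2)[OF x])
        have "cos t \<le> cos (2 * pi / 3)" using p that by (intro cos_monotone_0_pi_le) auto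
        then show "cos t \<le> -1/2" by (simp add: cos_120)
      qed
      from DERIV_imp_vertical_bound[OF \<Psi>(1) _ this]
      have "\<bar>Im (\<Psi> (Complex (?y p) pi)) - ?g p\<bar> \<le> exp ((b + 1) * ?y p - exp (?y p) / 2 + x * exp (a * ?y p)) * (pi - p)"
        using p by simp
      also have "\<dots> \<le> ?B (?y p)" using p by (intro mult_left_mono) (auto intro: order_trans[OF _ less_imp_le])
      finally show "norm (?g p - Im (\<Psi> (Complex (?y p) pi))) \<le> ?B (?y p)" by (simp add: abs_minus_commute)
    qed simp
    have "(?B \<longlongrightarrow> 0) at_top" using a b x by real_asymp
    then show "((\<lambda>p. ?B (?y p)) \<longlongrightarrow> 0) (at_left pi)"
      by (rule filterlim_compose[OF _ y])
  qed
  from tendsto_add[OF this filterlim_compose[OF Im_primitive_at_top[OF b x \<Psi>] y]]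
  have "(?g \<longlongrightarrow> pi * F b x) (at_left pi)" by simp
  then have "((\<lambda>p. X powr - (b + 1) * ?g p) \<longlongrightarrow> X powr - (b + 1) * (pi * F b x)) (at_left pi)"
    by (intro tendsto_intros)
  ultimately show ?thesis using that[OF der] by (simp add: x_def)
qed

end

section \<open>Zeros\<close>


text \<open>A continuous derivative without zeros has one sign on the connected set
  \<open>S\<close>, and \<open>deriv_nonneg_limits\<close>, applied to \<open>g\<close> or
  \<open>- g\<close>, would then separate the two limits.\<close>

lemma deriv_zero_between_limits:
  fixes g g' :: "real \<Rightarrow> real"
  assumes S: "convex S" "open S"
    and der: "\<And>p. p \<in> S \<Longrightarrow> (g has_real_derivative g' p) (at p)"
    and cont: "continuous_on S g'"
    and L: "L \<noteq> bot" "\<And>p. p \<in> S \<Longrightarrow> eventually (\<lambda>x. x \<in> S \<and> x \<le> p) L" "(g \<longlongrightarrow> c) L"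
    and R: "R \<noteq> bot" "\<And>p. p \<in> S \<Longrightarrow> eventually (\<lambda>x. x \<in> S \<and> p \<le> x) R" "(g \<longlongrightarrow> c) R"
    and p: "p \<in> S"
  shows "\<exists>q\<in>S. g' q = 0"
proof (rule ccontr)
  assume no: "\<not> (\<exists>q\<in>S. g' q = 0)"
  have conn: "connected (g' ` S)"
    by (intro connected_continuous_image cont convex_connected S)
  have same: "0 < g' q \<longleftrightarrow> 0 < g' p" if "q \<in> S" for q
  proof -
    have "0 \<notin> g' ` S" using no by force
    then show ?thesis
      using connectedD_interval[OF conn, of "g' q" "g' p" 0] connectedD_interval[OF conn, of "g' p" "g' q" 0] that p
      by (metis image_eqI less_imp_le not_le)
  qed
  show False
  proof (cases "0 < g' p")
    case True
    then show False
      using deriv_nonneg_limits(2)[OF S(1) der _ L R p] same no p S by (metis less_imp_le less_irrefl)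
  next
    case False
    have "((\<lambda>p. - g p) has_real_derivative - g' q) (at q)" if "q \<in> S" for q
      using der[OF that] by (rule DERIV_minus)
    moreover have "0 \<le> - g' q" if "q \<in> S" for q
      using same[OF that] False by simp
    ultimately have "- c < - c"
      using deriv_nonneg_limits(2)[OF S(1) _ _ L(1,2) tendsto_minus[OF L(3)] R(1,2) tendsto_minus[OF R(3)] p, of "\<lambda>q. - g' q"] no p S
      by auto
    then show False by simp
  qed
qed

text \<open>After division by the middle exponential, the combination is a convex function minus a constant.\<close>
lemma three_exponentials:
  fixes X1 X2 X3 s t :: real
  assumes X: "X1 < X2" "X2 < X3" and st: "s < t"
  obtains c1 c2 c3 where
    "\<And>u. u < s \<or> t < u \<Longrightarrow> 0 < c1 * exp (- X1 * u) + c2 * exp (- X2 * u) + c3 * exp (- X3 * u)"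
    "\<And>u. s < u \<Longrightarrow> u < t \<Longrightarrow> c1 * exp (- X1 * u) + c2 * exp (- X2 * u) + c3 * exp (- X3 * u) < 0"
    "\<And>u. u = s \<or> u = t \<Longrightarrow> c1 * exp (- X1 * u) + c2 * exp (- X2 * u) + c3 * exp (- X3 * u) = 0"
proof -
  define P where "P = X2 - X1"
  define Q where "Q = X3 - X2"
  have PQ: "0 < P" "0 < Q" using X by (simp_all add: P_def Q_def)
  \<comment> \<open>These positive coefficients are chosen so that the convex function
    \<open>H\<close> takes the same value at \<open>s\<close> and \<open>t\<close>; that value,
    negated, is the middle coefficient.\<close>
  define c1 where "c1 = exp (- Q * s) - exp (- Q * t)"
  define c3 where "c3 = exp (P * t) - exp (P * s)"
  have c: "0 < c1" "0 < c3" using PQ st by (simp_all add: c1_def c3_def)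
  define H where "H u = c1 * exp (P * u) + c3 * exp (- Q * u)" for u
  define H' where "H' u = c1 * P * exp (P * u) - c3 * Q * exp (- Q * u)" for u
  have H: "(H has_real_derivative H' u) (at u)" for u
    unfolding H_def H'_def by (auto intro!: derivative_eq_intros)
  have eq: "H s = H t" by (simp add: H_def c1_def c3_def algebra_simps)
  have mono: "H' u < H' v" if "u < v" for u v
    using that c PQ by (simp add: H'_def add_strict_mono diff_strict_mono mult_strict_left_mono)
  have mvt: "\<exists>z. u < z \<and> z < v \<and> H v - H u = (v - u) * H' z" if "u < v" for u v
    using MVT2[OF that, of H H'] H by blast
  obtain z where z: "s < z" "z < t" "H' z = 0"
    using mvt[OF st] eq st by auto
  have neg: "H v < H u" if "u < v" "v \<le> z" for u v
    using mvt[OF that(1)] mono[of _ z] that z(3) by (smt (verit) mult_pos_neg)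
  have pos: "H u < H v" if "u < v" "z \<le> u" for u v
    using mvt[OF that(1)] mono[of z] that z(3) by (smt (verit) mult_pos_pos)
  have K: "c1 * exp (- X1 * u) + (- H s) * exp (- X2 * u) + c3 * exp (- X3 * u) = exp (- X2 * u) * (H u - H s)" for u
  proof -
    have "exp (- X1 * u) = exp (- X2 * u) * exp (P * u)" "exp (- X3 * u) = exp (- X2 * u) * exp (- Q * u)"
      unfolding exp_add[symmetric] by (simp_all add: P_def Q_def algebra_simps)
    then show ?thesis unfolding H_def[of u] by (simp only:) (simp add: algebra_simps)
  qed
  show ?thesis
  proof (rule that[of c1 "- H s" c3]; unfold K)
    show "0 < exp (- X2 * u) * (H u - H s)" if "u < s \<or> t < u" for u
      using that neg[of u s] pos[of t u] z eq by (intro mult_pos_pos) auto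
    show "exp (- X2 * u) * (H u - H s) < 0" if "s < u" "u < t" for u
      using that neg[of s u] pos[of u t] z eq by (intro mult_pos_neg) (auto, fastforce)
    show "exp (- X2 * u) * (H u - H s) = 0" if "u = s \<or> u = t" for u
      using that eq by auto
  qed
qed

context wright_index
begin

section \<open>The differential relation between orders \<open>b - 1\<close> and
  \<open>b\<close>\<close>

text \<open>By the functional equation of \<open>rGamma\<close>, the coefficients of
  \<open>F b\<close> are those of \<open>F (b - 1)\<close> times \<open>- b - a * n\<close>. The
  factor \<open>n\<close> corresponds to \<open>x d/dx\<close>, so \<open>F b\<close> equals
  \<open>- b F (b - 1) - a x F (b - 1)'\<close>.\<close>

lemma F_power_series:
  assumes "0 < b"
  shows "isCont (F (b - 1)) x"
    and "x \<noteq> 0 \<Longrightarrow> (F (b - 1) has_real_derivative - (F b x + b * F (b - 1) x) / (a * x)) (at x)"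
proof -
  define c where "c n = rGamma (- (b - 1) - a * real n) / fact n" for n
  define D where "D z = (\<Sum>n. c n * z ^ n)" for z
  define D' where "D' z = (\<Sum>n. diffs c n * z ^ n)" for z
  have sums: "(\<lambda>n. c n * (- x) ^ n) sums F (b - 1) x" for x
    using F_sums(1)[of "b - 1" x] assms by (simp add: c_def mult.commute)
  then have summ: "summable (\<lambda>n. c n * z ^ n)" for z
    using sums_summable[OF sums[of "- z"]] by simp
  have F_D: "F (b - 1) x = D (- x)" for x
    unfolding D_def using sums[of x] by (rule sums_unique)
  have D: "(D has_real_derivative D' z) (at z)" for z
    unfolding D_def[abs_def] D'_def using summ by (rule termdiffs_strong_converges_everywhere)
  have F': "(F (b - 1) has_real_derivative - D' (- x)) (at x)" for x
  proof -
    have "((\<lambda>x. D (- x)) has_real_derivative D' (- x) * - 1) (at x)"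
      by (rule DERIV_chain2[OF D]) (auto intro!: derivative_eq_intros)
    then show ?thesis by (simp add: F_D[abs_def])
  qed
  then show "isCont (F (b - 1)) x" by (rule DERIV_isCont)
  have "summable (\<lambda>n. diffs c n * (- x) ^ n)"
    by (rule termdiff_converges_all[OF summ])
  from sums_mult[OF diffs_equiv[OF this], of "a * - x"]
  have "(\<lambda>n. a * (- x) * (of_nat n * c n * (- x) ^ (n - Suc 0))) sums (a * (- x) * D' (- x))"
    by (simp add: D'_def)
  also have "(\<lambda>n. a * (- x) * (of_nat n * c n * (- x) ^ (n - Suc 0))) = (\<lambda>n. a * real n * (c n * (- x) ^ n))"
  proof
    show "a * (- x) * (of_nat n * c n * (- x) ^ (n - Suc 0)) = a * real n * (c n * (- x) ^ n)" for n
      by (cases n) simp_all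
  qed
  finally have "(\<lambda>n. - b * (c n * (- x) ^ n) - a * real n * (c n * (- x) ^ n)) sums (- b * F (b - 1) x - a * (- x) * D' (- x))"
    by (intro sums_diff sums_mult sums)
  moreover have "- b * (c n * (- x) ^ n) - a * real n * (c n * (- x) ^ n) = (- x) ^ n / fact n * rGamma (- b - a * n)" for n
  proof -
    define q where "q = (- x) ^ n / fact n"
    have c: "c n * (- x) ^ n = q * rGamma (- (b - 1) - a * n)" by (simp add: c_def q_def)
    have r: "rGamma (- b - a * n) = (- b - a * n) * rGamma (- (b - 1) - a * n)"
      using rGamma_plus1[of "- b - a * n"] by (simp add: algebra_simps)
    show ?thesis unfolding c r q_def[symmetric] by (simp add: algebra_simps)
  qed
  ultimately have "F b x = - b * F (b - 1) x - a * (- x) * D' (- x)"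
    using F_sums(1)[of b x] assms by (simp add: sums_iff)
  then show "(F (b - 1) has_real_derivative - (F b x + b * F (b - 1) x) / (a * x)) (at x)" if "x \<noteq> 0"
    using F'[of x] a that by (simp add: field_simps)
qed

lemma F_isCont: "-1 < b \<Longrightarrow> isCont (F b) x"
  using F_power_series(1)[of "b + 1" x] by simp

section \<open>Sign changes of the weight\<close>

text \<open>The factor \<open>s\<close> only carries the overall sign. In \<open>sign1\<close> and
  \<open>sign2\<close> nothing is asked at the change points, where the test combinations
  vanish.\<close>

definition sign0 :: "real \<Rightarrow> real \<Rightarrow> bool" where
  "sign0 b s \<longleftrightarrow> (\<forall>p. 0 < p \<longrightarrow> p < pi \<longrightarrow> 0 < s * w b p)"

definition sign1 :: "real \<Rightarrow> real \<Rightarrow> real \<Rightarrow> bool" where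
  "sign1 b s q \<longleftrightarrow> 0 < q \<and> q < pi \<and> (\<forall>p. 0 < p \<longrightarrow> p < q \<longrightarrow> 0 < s * w b p) \<and>
     (\<forall>p. q < p \<longrightarrow> p < pi \<longrightarrow> s * w b p < 0)"

text \<open>A single overall sign suffices: the phase increases within (-pi/2, 5 pi/2) for
  \<open>0 < b < 2\<close>, so two changes can only be plus, minus, plus.\<close>

definition sign2 :: "real \<Rightarrow> real \<Rightarrow> real \<Rightarrow> bool" where
  "sign2 b q r \<longleftrightarrow> 0 < q \<and> q < r \<and> r < pi \<and> (\<forall>p. 0 < p \<longrightarrow> p < q \<longrightarrow> 0 < w b p) \<and>
     (\<forall>p. q < p \<longrightarrow> p < r \<longrightarrow> w b p < 0) \<and> (\<forall>p. r < p \<longrightarrow> p < pi \<longrightarrow> 0 < w b p)"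

lemma w_sign_iff_cos_phase:
  assumes "0 < p" "p < pi"
  shows "0 < w b p \<longleftrightarrow> 0 < cos (phase b p)" "w b p < 0 \<longleftrightarrow> cos (phase b p) < 0"
proof -
  obtain v where "0 < v" "w b p = v * cos (phase b p)"
    by (rule w_eq_cos_phase[OF assms])
  then show "0 < w b p \<longleftrightarrow> 0 < cos (phase b p)" "w b p < 0 \<longleftrightarrow> cos (phase b p) < 0"
    by (simp_all add: zero_less_mult_iff mult_less_0_iff)
qed

lemma cos_sign:
  "- (pi / 2) < t \<Longrightarrow> t < pi / 2 \<Longrightarrow> 0 < cos t"
  "pi / 2 < t \<Longrightarrow> t < 3 * pi / 2 \<Longrightarrow> cos t < 0"
  "3 * pi / 2 < t \<Longrightarrow> t < 5 * pi / 2 \<Longrightarrow> 0 < cos t"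
  using cos_gt_zero_pi[of t] cos_gt_zero_pi[of "t - pi"] cos_gt_zero_pi[of "t - 2 * pi"]
  by (simp_all add: cos_diff)

lemma phase_range:
  assumes "0 < b" "0 < p" "p < pi"
  shows "- (pi / 2) < phase b p" "phase b p < b * pi + pi / 2"
proof -
  have "0 < b * p" "b * p < b * pi" using assms by simp_all
  then show "- (pi / 2) < phase b p" "phase b p < b * pi + pi / 2"
    using arctan_bounded[of "E p"] by (simp_all add: phase_def)
qed

lemma w_sign:
  assumes b: "0 < b" and p: "0 < p" "p < pi"
  shows "phase b p < pi / 2 \<Longrightarrow> 0 < w b p"
    and "pi / 2 < phase b p \<Longrightarrow> phase b p < 3 * pi / 2 \<Longrightarrow> w b p < 0"
    and "b < 2 \<Longrightarrow> 3 * pi / 2 < phase b p \<Longrightarrow> 0 < w b p"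
proof -
  note r = phase_range[OF b p]
  show "phase b p < pi / 2 \<Longrightarrow> 0 < w b p"
    using r cos_sign(1) by (simp add: w_sign_iff_cos_phase[OF p])
  show "pi / 2 < phase b p \<Longrightarrow> phase b p < 3 * pi / 2 \<Longrightarrow> w b p < 0"
    using cos_sign(2) by (simp add: w_sign_iff_cos_phase[OF p])
  assume "b < 2" "3 * pi / 2 < phase b p"
  moreover from \<open>b < 2\<close> have "b * pi < 2 * pi" by simp
  with r have "phase b p < 5 * pi / 2" by linarith
  ultimately show "0 < w b p" using cos_sign(3) by (simp only: w_sign_iff_cos_phase[OF p])
qed

text \<open>The continuous, strictly increasing phase meets the level \<open>c\<close> at most once.
  The case distinction avoids computing its limits at 0 and pi.\<close>

lemma phase_threshold:
  assumes "0 < b"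
  obtains "\<And>p. 0 < p \<Longrightarrow> p < pi \<Longrightarrow> phase b p < c" | "\<And>p. 0 < p \<Longrightarrow> p < pi \<Longrightarrow> c < phase b p"
    | q where "0 < q" "q < pi" "phase b q = c" "\<And>p. 0 < p \<Longrightarrow> p < q \<Longrightarrow> phase b p < c"
        "\<And>p. q < p \<Longrightarrow> p < pi \<Longrightarrow> c < phase b p"
proof -
  have conn: "connected (phase b ` {0<..<pi})"
    by (intro connected_continuous_image phase_continuous) simp
  show ?thesis
  proof (cases "c \<in> phase b ` {0<..<pi}")
    case True
    then obtain q where q: "0 < q" "q < pi" "phase b q = c" by auto
    show ?thesis
    proof (rule that(3)[OF q])
      show "phase b p < c" if "0 < p" "p < q" for p
        using phase_strict_mono[OF assms, of p q] q that by simp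
      show "c < phase b p" if "q < p" "p < pi" for p
        using phase_strict_mono[OF assms, of q p] q that by simp
    qed
  next
    case False
    \<comment> \<open>The number 1 serves as a reference point of the interval; by connectedness the
      phase stays on the same side of \<open>c\<close> as there.\<close>
    have one: "1 \<in> {0<..<pi}" using pi_gt3 by simp
    show ?thesis
    proof (cases "phase b 1 < c")
      case True
      have "phase b p < c" if "0 < p" "p < pi" for p
      proof (rule ccontr)
        assume "\<not> phase b p < c"
        then have "c \<in> phase b ` {0<..<pi}"
          using connectedD_interval[OF conn imageI[of 1] imageI[of p], of c] one that True by simp
        then show False using False by simp
      qed
      then show ?thesis by (rule that(1))
    next
      case False': False
      have "c < phase b p" if "0 < p" "p < pi" for p
      proof (rule ccontr)
        assume "\<not> c < phase b p"
        then have "c \<in> phase b ` {0<..<pi}"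
          using connectedD_interval[OF conn imageI[of p] imageI[of 1], of c] one that False' by simp
        then show False using False by simp
      qed
      then show ?thesis by (rule that(2))
    qed
  qed
qed

text \<open>Here the phase stays below 3 pi/2, so the sign can change only at the level
  pi/2.\<close>

lemma w_sign_change_le_1:
  assumes "0 < b" "b \<le> 1"
  shows "(\<exists>s. (s = 1 \<or> s = -1) \<and> sign0 b s) \<or> (\<exists>s q. (s = 1 \<or> s = -1) \<and> sign1 b s q)"
proof -
  have "phase b p < 3 * pi / 2" if "0 < p" "p < pi" for p
  proof -
    have "b * pi \<le> pi" using assms by simp
    then show ?thesis using phase_range[OF assms(1) that] by linarith
  qed
  note w = w_sign(1,2)[OF assms(1)] this
  show ?thesis
  proof (rule phase_threshold[OF assms(1), of "pi / 2"])
    assume "\<And>p. 0 < p \<Longrightarrow> p < pi \<Longrightarrow> phase b p < pi / 2"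
    then have "sign0 b 1" using w by (simp add: sign0_def)
    then show ?thesis by blast
  next
    assume "\<And>p. 0 < p \<Longrightarrow> p < pi \<Longrightarrow> pi / 2 < phase b p"
    then have "sign0 b (-1)" using w by (simp add: sign0_def)
    then show ?thesis by blast
  next
    fix q assume "0 < q" "q < pi" "\<And>p. 0 < p \<Longrightarrow> p < q \<Longrightarrow> phase b p < pi / 2"
        "\<And>p. q < p \<Longrightarrow> p < pi \<Longrightarrow> pi / 2 < phase b p"
    then have "sign1 b 1 q" using w by (simp add: sign1_def)
    then show ?thesis by blast
  qed
qed

lemma w_sign_change_le_2:
  assumes "0 < b" "b < 2"
  shows "(\<exists>s. sign0 b s) \<or> (\<exists>s q. sign1 b s q) \<or> (\<exists>q r. sign2 b q r)"
proof -
  note w = w_sign(1,2)[OF assms(1)] w_sign(3)[OF assms(1) _ _ assms(2)]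
  show ?thesis
  proof (rule phase_threshold[OF assms(1), of "pi / 2"])
    assume "\<And>p. 0 < p \<Longrightarrow> p < pi \<Longrightarrow> phase b p < pi / 2"
    then have "sign0 b 1" using w(1) by (simp add: sign0_def)
    then show ?thesis by blast
  next
    assume lo: "\<And>p. 0 < p \<Longrightarrow> p < pi \<Longrightarrow> pi / 2 < phase b p"
    show ?thesis
    proof (rule phase_threshold[OF assms(1), of "3 * pi / 2"])
      assume "\<And>p. 0 < p \<Longrightarrow> p < pi \<Longrightarrow> phase b p < 3 * pi / 2"
      then have "sign0 b (-1)" using lo w(2) by (simp add: sign0_def)
      then show ?thesis by blast
    next
      assume "\<And>p. 0 < p \<Longrightarrow> p < pi \<Longrightarrow> 3 * pi / 2 < phase b p"
      then have "sign0 b 1" using w(3) by (simp add: sign0_def)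
      then show ?thesis by blast
    next
      fix q assume "0 < q" "q < pi" "\<And>p. 0 < p \<Longrightarrow> p < q \<Longrightarrow> phase b p < 3 * pi / 2"
        "\<And>p. q < p \<Longrightarrow> p < pi \<Longrightarrow> 3 * pi / 2 < phase b p"
      then have "sign1 b (-1) q" using lo w(2,3) by (simp add: sign1_def)
      then show ?thesis by blast
    qed
  next
    fix q assume q: "0 < q" "q < pi" "phase b q = pi / 2" "\<And>p. 0 < p \<Longrightarrow> p < q \<Longrightarrow> phase b p < pi / 2"
        "\<And>p. q < p \<Longrightarrow> p < pi \<Longrightarrow> pi / 2 < phase b p"
    show ?thesis
    proof (rule phase_threshold[OF assms(1), of "3 * pi / 2"])
      assume "\<And>p. 0 < p \<Longrightarrow> p < pi \<Longrightarrow> phase b p < 3 * pi / 2"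
      then have "sign1 b 1 q" using q w(1,2) by (simp add: sign1_def)
      then show ?thesis by blast
    next
      assume "\<And>p. 0 < p \<Longrightarrow> p < pi \<Longrightarrow> 3 * pi / 2 < phase b p"
      from this[OF q(1,2)] q(3) have False using pi_gt_zero by linarith
      then show ?thesis ..
    next
      fix r assume r: "0 < r" "r < pi" "phase b r = 3 * pi / 2" "\<And>p. 0 < p \<Longrightarrow> p < r \<Longrightarrow> phase b p < 3 * pi / 2"
        "\<And>p. r < p \<Longrightarrow> p < pi \<Longrightarrow> 3 * pi / 2 < phase b p"
      have "q < r"
      proof (rule ccontr)
        assume "\<not> q < r"
        then have "phase b r \<le> phase b q" using q(4)[of r] r(1,3) q(3) by (cases "r = q") auto
        then show False using q(3) r(3) pi_gt_zero by linarith
      qed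
      then have "sign2 b q r" using q(1,4,5) r(2,4,5) w by (simp add: sign2_def)
      then show ?thesis by blast
    qed
  qed
qed

text \<open>Cotangent decreases, which gives \<open>- cot p < E p\<close> and hence
  \<open>arctan (E p) > p - pi / 2\<close>. As \<open>b > -1\<close>, the phase remains in (-pi/2,
  pi/2). This covers the nonpositive orders in the decay estimate.\<close>

lemma w_pos:
  assumes b: "-1 < b" "b \<le> 0"
  shows "sign0 b 1"
  unfolding sign0_def
proof (intro allI impI)
  fix p :: real assume p: "0 < p" "p < pi"
  note s = sin_pos[OF p]
  have "cot p < cot ((1 - a) * p)"
  proof -
    have "0 < sin (p - (1 - a) * p)" using s by (simp add: algebra_simps)
    then have "0 < sin p * cos ((1 - a) * p) - cos p * sin ((1 - a) * p)" by (simp only: sin_diff)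
    then show ?thesis using s by (simp add: cot_def field_simps)
  qed
  then have "(1 - a) * cot p < (1 - a) * cot ((1 - a) * p)" using a by simp
  then have "- cot p < E p" using a by (simp add: E_def field_simps)
  moreover have "arctan (- cot p) = p - pi / 2"
    using p s by (intro arctan_unique) (auto simp: tan_def cot_def sin_diff cos_diff)
  ultimately have "p - pi / 2 < arctan (E p)" using arctan_monotone by metis
  moreover have "0 < (b + 1) * p" using b p by simp
  then have "- p < b * p" by (simp add: distrib_right)
  moreover have "b * p \<le> 0" using b p by (simp add: mult_nonpos_nonneg)
  ultimately have "- (pi / 2) < phase b p" "phase b p < pi / 2"
    using arctan_bounded[of "E p"] by (auto simp: phase_def)
  then show "0 < 1 * w b p" using cos_sign(1) by (simp add: w_sign_iff_cos_phase[OF p])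
qed

section \<open>Upper bounds for the number of zeros\<close>

text \<open>At a zero both boundary limits of the primitive from \<open>steepest_descent\<close> are
  0, so every combination of exponentials integrates to 0 against \<open>w\<close>. An integrand of
  constant sign must then vanish throughout.\<close>

lemma no_signed_combination:
  fixes c :: "real \<Rightarrow> real"
  assumes b: "-1 < b" and I: "finite I"
    and zero: "\<And>X. X \<in> I \<Longrightarrow> 0 < X \<and> F b (X powr (1 - a)) = 0"
    and nonneg: "\<And>p. 0 < p \<Longrightarrow> p < pi \<Longrightarrow> 0 \<le> (\<Sum>X\<in>I. c X * exp (- X * A p)) * w b p"
    and q: "0 < q" "q < pi"
  shows "(\<Sum>X\<in>I. c X * exp (- X * A q)) * w b q = 0"
proof (rule ccontr)
  assume ne: "\<not> ?thesis"
  have "\<forall>X\<in>I. \<exists>m. (\<forall>p. 0 < p \<longrightarrow> p < pi \<longrightarrow> (m has_real_derivative exp (- X * A p) * w b p) (at p)) \<and>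
      (m \<longlongrightarrow> 0) (at_right 0) \<and> (m \<longlongrightarrow> 0) (at_left pi)"
  proof
    fix X assume "X \<in> I"
    with zero have X: "0 < X" "F b (X powr (1 - a)) = 0" by auto
    show "\<exists>m. (\<forall>p. 0 < p \<longrightarrow> p < pi \<longrightarrow> (m has_real_derivative exp (- X * A p) * w b p) (at p)) \<and>
      (m \<longlongrightarrow> 0) (at_right 0) \<and> (m \<longlongrightarrow> 0) (at_left pi)"
      by (rule steepest_descent[OF b X(1)]) (use X(2) in auto)
  qed
  then obtain m where m:
    "\<And>X p. X \<in> I \<Longrightarrow> 0 < p \<Longrightarrow> p < pi \<Longrightarrow> (m X has_real_derivative exp (- X * A p) * w b p) (at p)"
    "\<And>X. X \<in> I \<Longrightarrow> (m X \<longlongrightarrow> 0) (at_right 0)" "\<And>X. X \<in> I \<Longrightarrow> (m X \<longlongrightarrow> 0) (at_left pi)"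
    by (auto dest!: bchoice)
  let ?M = "\<lambda>p. \<Sum>X\<in>I. c X * m X p"
  have der: "(?M has_real_derivative (\<Sum>X\<in>I. c X * exp (- X * A p)) * w b p) (at p)" if "0 < p" "p < pi" for p
    unfolding sum_distrib_right mult.assoc by (intro DERIV_sum DERIV_cmult m that)
  have lim: "(?M \<longlongrightarrow> (\<Sum>X\<in>I. c X * 0)) (at_right 0)" "(?M \<longlongrightarrow> (\<Sum>X\<in>I. c X * 0)) (at_left pi)"
    by (intro tendsto_intros m; assumption)+
  have "(\<Sum>X\<in>I. c X * 0) < (\<Sum>X\<in>I. c X * 0)"
    by (rule deriv_nonneg_limits_interval(2)[OF pi_gt_zero der nonneg lim q ne])
  then show False by simp
qed

lemma sign0_no_zero:
  assumes "-1 < b" "sign0 b s" "0 < X"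
  shows "F b (X powr (1 - a)) \<noteq> 0"
proof
  assume "F b (X powr (1 - a)) = 0"
  moreover have "0 \<le> (\<Sum>Y\<in>{X}. s * exp (- Y * A p)) * w b p" if "0 < p" "p < pi" for p
  proof -
    have "0 < exp (- X * A p) * (s * w b p)" using assms that by (simp add: sign0_def)
    then show ?thesis by (simp add: mult_ac)
  qed
  ultimately have "(\<Sum>Y\<in>{X}. s * exp (- Y * A 1)) * w b 1 = 0"
    using assms pi_gt3 by (intro no_signed_combination) auto
  moreover have "0 < s * w b 1" using assms pi_gt3 by (auto simp: sign0_def)
  ultimately show False by auto
qed

lemma sign1_one_zero:
  assumes b: "-1 < b" and sg: "sign1 b s q" and X: "0 < X" "X < Y"
    and z: "F b (X powr (1 - a)) = 0" "F b (Y powr (1 - a)) = 0"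
  shows False
proof -
  \<comment> \<open>Normalised so that the two exponentials cancel exactly where
    \<open>A p = A q\<close>, which is the sign change of \<open>w\<close>.\<close>
  let ?c = "\<lambda>Z. if Z = X then - s * exp (X * A q) else s * exp (Y * A q)"
  have K: "(\<Sum>Z\<in>{X, Y}. ?c Z * exp (- Z * A p)) * w b p
      = (exp (Y * (A q - A p)) - exp (X * (A q - A p))) * (s * w b p)" for p
    using X by (simp add: right_diff_distrib exp_diff exp_minus algebra_simps divide_inverse)
  have q: "0 < q" "q < pi" using sg by (auto simp: sign1_def)
  have nonneg: "0 \<le> (\<Sum>Z\<in>{X, Y}. ?c Z * exp (- Z * A p)) * w b p" if p: "0 < p" "p < pi" for p
  proof (cases p q rule: linorder_cases)
    case less
    then have "0 < A q - A p" using A_strict_mono p q by auto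
    then have "X * (A q - A p) < Y * (A q - A p)" using X by simp
    moreover have "0 < s * w b p" using less p sg by (simp add: sign1_def)
    ultimately show ?thesis unfolding K by simp
  next
    case equal
    then show ?thesis unfolding K by simp
  next
    case greater
    then have "A q - A p < 0" using A_strict_mono p q by auto
    then have "Y * (A q - A p) < X * (A q - A p)" using X by simp
    moreover have "s * w b p < 0" using greater p sg by (simp add: sign1_def)
    ultimately show ?thesis unfolding K by (intro mult_nonpos_nonpos) auto
  qed
  \<comment> \<open>\<open>q / 2\<close> is merely a point off the sign change, where the product is
    nonzero.\<close>
  have p: "0 < q / 2" "q / 2 < q" "q / 2 < pi" using q by auto
  have "(\<Sum>Z\<in>{X, Y}. ?c Z * exp (- Z * A (q / 2))) * w b (q / 2) = 0"
    by (rule no_signed_combination[OF b _ _ nonneg p(1,3)]) (use X z in auto)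
  moreover have "0 < s * w b (q / 2)" using p sg by (simp add: sign1_def)
  moreover have "X * (A q - A (q / 2)) \<noteq> Y * (A q - A (q / 2))"
    using A_strict_mono[OF p(1,2) q(2)] X by auto
  ultimately show False unfolding K by auto
qed

text \<open>Apply \<open>three_exponentials\<close> at the levels \<open>A q\<close> and
  \<open>A r\<close>. As \<open>A\<close> is strictly increasing, the combination changes sign
  together with \<open>w\<close> and their product is never negative.\<close>

lemma sign2_two_zeros:
  assumes b: "-1 < b" and sg: "sign2 b q r" and X: "0 < X" "X < Y" "Y < Z"
    and z: "F b (X powr (1 - a)) = 0" "F b (Y powr (1 - a)) = 0" "F b (Z powr (1 - a)) = 0"
  shows False
proof -
  have q: "0 < q" "q < r" "r < pi" using sg by (auto simp: sign2_def)
  obtain c1 c2 c3 where c: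
    "\<And>u. u < A q \<or> A r < u \<Longrightarrow> 0 < c1 * exp (- X * u) + c2 * exp (- Y * u) + c3 * exp (- Z * u)"
    "\<And>u. A q < u \<Longrightarrow> u < A r \<Longrightarrow> c1 * exp (- X * u) + c2 * exp (- Y * u) + c3 * exp (- Z * u) < 0"
    "\<And>u. u = A q \<or> u = A r \<Longrightarrow> c1 * exp (- X * u) + c2 * exp (- Y * u) + c3 * exp (- Z * u) = 0"
    using three_exponentials[OF X(2,3) A_strict_mono[OF q]] by metis
  let ?c = "\<lambda>V. if V = X then c1 else if V = Y then c2 else c3"
  let ?K = "\<lambda>p. \<Sum>V\<in>{X, Y, Z}. ?c V * exp (- V * A p)"
  have K: "?K p = c1 * exp (- X * A p) + c2 * exp (- Y * A p) + c3 * exp (- Z * A p)" for p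
    using X by (simp add: add.assoc)
  have pos: "0 < ?K p * w b p" if p: "0 < p" "p < pi" "p \<noteq> q" "p \<noteq> r" for p
  proof -
    consider "p < q" | "q < p" "p < r" | "r < p" using p by linarith
    then show ?thesis
    proof cases
      case 1
      then have "A p < A q" using A_strict_mono p q by auto
      then show ?thesis unfolding K using c(1) sg 1 p by (intro mult_pos_pos) (auto simp: sign2_def)
    next
      case 2
      then have "A q < A p" "A p < A r" using A_strict_mono p q by auto
      then show ?thesis unfolding K using c(2) sg 2 p by (intro mult_neg_neg) (auto simp: sign2_def)
    next
      case 3
      then have "A r < A p" using A_strict_mono p q by auto
      then show ?thesis unfolding K using c(1) sg 3 p by (intro mult_pos_pos) (auto simp: sign2_def)
    qed
  qed
  have nonneg: "0 \<le> ?K p * w b p" if p: "0 < p" "p < pi" for p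
  proof (cases "p = q \<or> p = r")
    case True
    then have "?K p = 0" unfolding K using c(3)[of "A p"] by auto
    then show ?thesis by simp
  qed (use pos[OF p] in auto)
  have p: "0 < q / 2" "q / 2 < pi" "q / 2 \<noteq> q" "q / 2 \<noteq> r" using q by auto
  have "?K (q / 2) * w b (q / 2) = 0"
    by (rule no_signed_combination[OF b _ _ nonneg p(1,2)]) (use X z in auto)
  then show False using pos[OF p] by (simp only: less_irrefl)
qed

section \<open>Decay at infinity\<close>

text \<open>From \<open>A p \<ge> A0\<close> and \<open>X \<ge> 1\<close> follows
  \<open>exp (- X * A p) \<le> exp (- (X - 1) * A0) * exp (- A p)\<close>. Where \<open>w\<close>
  keeps its sign, the increment of \<open>m\<close> is thus controlled by that of \<open>n\<close>,
  the case \<open>X = 1\<close>.\<close>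

lemma exponential_comparison:
  assumes lr: "0 \<le> l" "l < r" "r \<le> pi" and X: "1 \<le> X" and s: "s = 1 \<or> s = -1"
    and w: "\<And>p. l < p \<Longrightarrow> p < r \<Longrightarrow> 0 \<le> s * w b p"
    and m: "\<And>p. l < p \<Longrightarrow> p < r \<Longrightarrow> (m has_real_derivative exp (- X * A p) * w b p) (at p)"
      "(m \<longlongrightarrow> u) (at_right l)" "(m \<longlongrightarrow> v) (at_left r)"
    and n: "\<And>p. l < p \<Longrightarrow> p < r \<Longrightarrow> (n has_real_derivative exp (- 1 * A p) * w b p) (at p)"
      "(n \<longlongrightarrow> u') (at_right l)" "(n \<longlongrightarrow> v') (at_left r)"
  shows "\<bar>v - u\<bar> \<le> exp (- (X - 1) * A0) * \<bar>v' - u'\<bar>"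
proof -
  let ?d = "exp (- (X - 1) * A0)"
  have "s * u \<le> s * v"
  proof (rule deriv_nonneg_limits_interval(1)[OF lr(2)])
    fix p assume p: "l < p" "p < r"
    show "((\<lambda>p. s * m p) has_real_derivative exp (- X * A p) * (s * w b p)) (at p)"
      using DERIV_cmult[OF m(1)[OF p], of s] by (simp add: mult_ac)
    show "0 \<le> exp (- X * A p) * (s * w b p)" using w[OF p] by simp
  qed (intro tendsto_intros m)+
  moreover have "?d * (s * u') - s * u \<le> ?d * (s * v') - s * v"
  proof (rule deriv_nonneg_limits_interval(1)[OF lr(2)])
    fix p assume p: "l < p" "p < r"
    show "((\<lambda>p. ?d * (s * n p) - s * m p) has_real_derivative (?d * exp (- 1 * A p) - exp (- X * A p)) * (s * w b p)) (at p)"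
      using DERIV_diff[OF DERIV_cmult[OF DERIV_cmult[OF n(1)[OF p], of s], of ?d] DERIV_cmult[OF m(1)[OF p], of s]]
      by (simp add: algebra_simps)
    have "(X - 1) * A0 \<le> (X - 1) * A p" using A_ge[of p] p lr X by (intro mult_left_mono) auto
    then have "exp (- X * A p) \<le> exp (- (X - 1) * A0 + (- 1 * A p))"
      by (simp add: algebra_simps)
    then have "exp (- X * A p) \<le> ?d * exp (- 1 * A p)"
      by (simp only: exp_add)
    then show "0 \<le> (?d * exp (- 1 * A p) - exp (- X * A p)) * (s * w b p)"
      using w[OF p] by simp
  qed (intro tendsto_intros m n)+
  ultimately have "0 \<le> s * (v - u)" "s * (v - u) \<le> ?d * (s * (v' - u'))"
    by (simp_all add: algebra_simps)
  moreover have "s * (v' - u') \<le> \<bar>v' - u'\<bar>" "\<bar>v - u\<bar> = \<bar>s * (v - u)\<bar>"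
    using s by auto
  ultimately show ?thesis
    by (smt (verit) exp_ge_zero mult_left_mono)
qed

text \<open>For \<open>b < 1\<close> the weight changes sign at most once, so the comparison with
  \<open>X = 1\<close> is made on at most two intervals and the contributions are added. The
  constant depends only on the data for \<open>X = 1\<close>.\<close>

lemma F_bound:
  assumes b: "-1 < b" "b < 1"
  shows "\<exists>C. \<forall>X\<ge>1. \<bar>F b (X powr (1 - a))\<bar> \<le> C * (X powr (b + 1) * exp (- (X - 1) * A0))"
proof -
  consider s where "s = 1 \<or> s = -1" "sign0 b s" | s q where "s = 1 \<or> s = -1" "sign1 b s q"
  proof (cases "b \<le> 0")
    case True
    then show ?thesis using w_pos[OF b(1)] that(1) by blast
  next
    case False
    then show ?thesis using w_sign_change_le_1[of b] b that by auto
  qed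
  then have "\<exists>C. \<forall>X\<ge>1. \<bar>X powr - (b + 1) * (pi * F b (X powr (1 - a)))\<bar> \<le> exp (- (X - 1) * A0) * C"
  proof cases
    case (1 s)
    obtain n where n: "\<And>p. 0 < p \<Longrightarrow> p < pi \<Longrightarrow> (n has_real_derivative exp (- 1 * A p) * w b p) (at p)"
      "(n \<longlongrightarrow> 0) (at_right 0)" "(n \<longlongrightarrow> 1 powr - (b + 1) * (pi * F b (1 powr (1 - a)))) (at_left pi)"
      using steepest_descent[OF b(1), of 1] by auto
    show ?thesis
    proof (intro exI allI impI)
      fix X :: real assume X: "1 \<le> X"
      obtain m where m: "\<And>p. 0 < p \<Longrightarrow> p < pi \<Longrightarrow> (m has_real_derivative exp (- X * A p) * w b p) (at p)"
        "(m \<longlongrightarrow> 0) (at_right 0)" "(m \<longlongrightarrow> X powr - (b + 1) * (pi * F b (X powr (1 - a)))) (at_left pi)"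
        using steepest_descent[OF b(1), of X] X by auto
      show "\<bar>X powr - (b + 1) * (pi * F b (X powr (1 - a)))\<bar>
          \<le> exp (- (X - 1) * A0) * \<bar>1 powr - (b + 1) * (pi * F b (1 powr (1 - a))) - 0\<bar>"
        using exponential_comparison[OF order_refl pi_gt_zero order_refl X 1(1) _ m n] 1(2)
        by (simp add: sign0_def less_imp_le)
    qed
  next
    case (2 s q)
    then have q: "0 < q" "q < pi" by (auto simp: sign1_def)
    obtain n where n: "\<And>p. 0 < p \<Longrightarrow> p < pi \<Longrightarrow> (n has_real_derivative exp (- 1 * A p) * w b p) (at p)"
      "(n \<longlongrightarrow> 0) (at_right 0)" "(n \<longlongrightarrow> 1 powr - (b + 1) * (pi * F b (1 powr (1 - a)))) (at_left pi)"
      using steepest_descent[OF b(1), of 1] by auto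
    have nq: "(n \<longlongrightarrow> n q) (at q within S)" for S
      using DERIV_isCont[OF n(1)[OF q]] by (metis isCont_def tendsto_within_subset subset_UNIV)
    show ?thesis
    proof (intro exI allI impI)
      fix X :: real assume X: "1 \<le> X"
      obtain m where m: "\<And>p. 0 < p \<Longrightarrow> p < pi \<Longrightarrow> (m has_real_derivative exp (- X * A p) * w b p) (at p)"
        "(m \<longlongrightarrow> 0) (at_right 0)" "(m \<longlongrightarrow> X powr - (b + 1) * (pi * F b (X powr (1 - a)))) (at_left pi)"
        using steepest_descent[OF b(1), of X] X by auto
      have mq: "(m \<longlongrightarrow> m q) (at q within S)" for S
        using DERIV_isCont[OF m(1)[OF q]] by (metis isCont_def tendsto_within_subset subset_UNIV)
      let ?L = "X powr - (b + 1) * (pi * F b (X powr (1 - a)))"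
      let ?L' = "1 powr - (b + 1) * (pi * F b (1 powr (1 - a)))"
      have "\<bar>m q - 0\<bar> \<le> exp (- (X - 1) * A0) * \<bar>n q - 0\<bar>"
      proof (rule exponential_comparison[OF order_refl q(1) less_imp_le[OF q(2)] X 2(1) _ _ m(2) mq _ n(2) nq])
        fix p assume p: "0 < p" "p < q"
        then have p': "p < pi" using q by simp
        show "0 \<le> s * w b p" using 2(2) p by (simp add: sign1_def less_imp_le)
        show "(m has_real_derivative exp (- X * A p) * w b p) (at p)"
          "(n has_real_derivative exp (- 1 * A p) * w b p) (at p)" by (rule m(1)[OF p(1) p'], rule n(1)[OF p(1) p'])
      qed
      moreover have "\<bar>?L - m q\<bar> \<le> exp (- (X - 1) * A0) * \<bar>?L' - n q\<bar>"
      proof (rule exponential_comparison[OF less_imp_le[OF q(1)] q(2) order_refl X, where s = "- s", OF _ _ _ mq m(3) _ nq n(3)])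
        show "- s = 1 \<or> - s = -1" using 2(1) by auto
        fix p assume p: "q < p" "p < pi"
        then have p': "0 < p" using q by simp
        show "0 \<le> - s * w b p" using 2(2) p by (simp add: sign1_def less_imp_le)
        show "(m has_real_derivative exp (- X * A p) * w b p) (at p)"
          "(n has_real_derivative exp (- 1 * A p) * w b p) (at p)" by (rule m(1)[OF p' p(2)], rule n(1)[OF p' p(2)])
      qed
      ultimately show "\<bar>?L\<bar> \<le> exp (- (X - 1) * A0) * (\<bar>n q - 0\<bar> + \<bar>?L' - n q\<bar>)"
        unfolding distrib_left by linarith
    qed
  qed
  then obtain C where C: "\<And>X. X \<ge> 1 \<Longrightarrow> \<bar>X powr - (b + 1) * (pi * F b (X powr (1 - a)))\<bar> \<le> exp (- (X - 1) * A0) * C"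
    by blast
  have "\<bar>F b (X powr (1 - a))\<bar> \<le> C / pi * (X powr (b + 1) * exp (- (X - 1) * A0))" if X: "X \<ge> 1" for X
  proof -
    have "X powr (b + 1) * X powr - (b + 1) = 1" using X by (simp only: powr_add[symmetric]) simp
    then have "X powr (b + 1) * \<bar>X powr - (b + 1) * (pi * F b (X powr (1 - a)))\<bar> = pi * \<bar>F b (X powr (1 - a))\<bar>"
      by (simp add: abs_mult mult.assoc[symmetric])
    moreover have "X powr (b + 1) * \<bar>X powr - (b + 1) * (pi * F b (X powr (1 - a)))\<bar>
        \<le> X powr (b + 1) * (exp (- (X - 1) * A0) * C)"
      using C[OF X] by (intro mult_left_mono) auto
    ultimately show ?thesis by (simp add: field_simps)
  qed
  then show ?thesis by blast
qed

lemma F_decay: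
  assumes b: "-1 < b" "b < 1"
  shows "((\<lambda>x. x powr k * F b x) \<longlongrightarrow> 0) at_top"
proof -
  obtain C where C: "\<And>X. X \<ge> 1 \<Longrightarrow> \<bar>F b (X powr (1 - a))\<bar> \<le> C * (X powr (b + 1) * exp (- (X - 1) * A0))"
    using F_bound[OF b] by blast
  \<comment> \<open>The exponent rescaled for the substitution
    \<open>x = X powr (1 - a)\<close>.\<close>
  let ?k = "(1 - a) * k"
  have "((\<lambda>X. X powr ?k * F b (X powr (1 - a))) \<longlongrightarrow> 0) at_top"
  proof (rule Lim_null_comparison)
    show "eventually (\<lambda>X. norm (X powr ?k * F b (X powr (1 - a))) \<le> X powr ?k * (C * (X powr (b + 1) * exp (- (X - 1) * A0)))) at_top"
      using eventually_ge_at_top[of 1]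
      by eventually_elim (use C in \<open>auto simp: abs_mult intro!: mult_left_mono\<close>)
    show "((\<lambda>X. X powr ?k * (C * (X powr (b + 1) * exp (- (X - 1) * A0)))) \<longlongrightarrow> 0) at_top"
      using A0_pos by real_asymp
  qed
  moreover have "filterlim (\<lambda>x. x powr (1 / (1 - a))) at_top at_top"
  proof -
    have "0 < 1 / (1 - a)" using a by simp
    then show ?thesis by real_asymp
  qed
  ultimately have "((\<lambda>x. (x powr (1 / (1 - a))) powr ?k * F b ((x powr (1 / (1 - a))) powr (1 - a))) \<longlongrightarrow> 0) at_top"
    by (rule filterlim_compose)
  then show ?thesis
    by (rule Lim_transform_eventually)
       (use eventually_gt_at_top[of 0] in eventually_elim, use a in \<open>simp add: powr_powr\<close>)
qed

section \<open>Lower bounds by Rolle's theorem\<close>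

text \<open>The power of \<open>x\<close> is the integrating factor of the relation in
  \<open>F_power_series\<close>: it removes \<open>F (b - 1)\<close> from the derivative and leaves
  a nonvanishing multiple of \<open>F b\<close> for \<open>x > 0\<close>.\<close>

definition G :: "real \<Rightarrow> real \<Rightarrow> real" where
  "G b x = x powr (b / a) * F (b - 1) x"

lemma G_deriv:
  assumes "0 < b" "0 < x"
  shows "(G b has_real_derivative - (x powr (b / a - 1) / a * F b x)) (at x)"
proof -
  have "(G b has_real_derivative (b / a * x powr (b / a - 1)) * F (b - 1) x
      + - (F b x + b * F (b - 1) x) / (a * x) * x powr (b / a)) (at x)"
    unfolding G_def[abs_def]
    using assms F_power_series(2)[OF assms(1), of x] by (intro DERIV_mult has_real_derivative_powr) auto
  also have "x powr (b / a) = x * x powr (b / a - 1)"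
    using assms by (simp add: powr_diff)
  also have "(b / a * x powr (b / a - 1)) * F (b - 1) x
      + - (F b x + b * F (b - 1) x) / (a * x) * (x * x powr (b / a - 1)) = - (x powr (b / a - 1) / a * F b x)"
    using a assms by (simp add: field_simps)
  finally show ?thesis .
qed

lemma G_tendsto_0: "0 < b \<Longrightarrow> (G b \<longlongrightarrow> 0) (at_right 0)"
proof -
  assume b: "0 < b"
  have "(F (b - 1) \<longlongrightarrow> F (b - 1) 0) (at_right 0)"
    using F_power_series(1)[OF b, of 0] by (metis isCont_def tendsto_within_subset subset_UNIV)
  moreover have "((\<lambda>x. x powr (b / a)) \<longlongrightarrow> 0) (at_right 0)"
  proof -
    have "0 < b / a" using a b by simp
    then show ?thesis by real_asymp
  qed
  ultimately have "((\<lambda>x. x powr (b / a) * F (b - 1) x) \<longlongrightarrow> 0 * F (b - 1) 0) (at_right 0)"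
    by (intro tendsto_mult)
  then show ?thesis by (simp add: G_def[abs_def])
qed

lemma G_rolle:
  assumes b: "0 < b" and S: "convex S" "open S" "S \<subseteq> {0<..}" "S \<noteq> {}"
    and L: "L \<noteq> bot" "\<And>p. p \<in> S \<Longrightarrow> eventually (\<lambda>x. x \<in> S \<and> x \<le> p) L" "(G b \<longlongrightarrow> 0) L"
    and R: "R \<noteq> bot" "\<And>p. p \<in> S \<Longrightarrow> eventually (\<lambda>x. x \<in> S \<and> p \<le> x) R" "(G b \<longlongrightarrow> 0) R"
  shows "\<exists>x\<in>S. F b x = 0"
proof -
  obtain p where p: "p \<in> S" using S by blast
  have "\<exists>x\<in>S. - (x powr (b / a - 1) / a * F b x) = 0"
  proof (rule deriv_zero_between_limits[OF S(1,2) _ _ L R p])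
    show "(G b has_real_derivative - (x powr (b / a - 1) / a * F b x)) (at x)" if "x \<in> S" for x
      using G_deriv[OF b] S(3) that by auto
    have "isCont (\<lambda>x. - (x powr (b / a - 1) / a * F b x)) x" if "x \<in> S" for x
      using a b S(3) that by (intro continuous_intros F_isCont) auto
    then show "continuous_on S (\<lambda>x. - (x powr (b / a - 1) / a * F b x))"
      by (intro continuous_at_imp_continuous_on) auto
  qed
  then show ?thesis using a S(3) by auto
qed

lemma F_has_zero:
  assumes "0 < b" "b < 2"
  shows "\<exists>x>0. F b x = 0"
proof -
  have "\<exists>x\<in>{0<..}. F b x = 0"
  proof (rule G_rolle[OF assms(1)])
    show "(G b \<longlongrightarrow> 0) (at_right 0)" using G_tendsto_0 assms by simp
    show "(G b \<longlongrightarrow> 0) at_top" unfolding G_def[abs_def] using F_decay assms by simp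
    fix p :: real assume "p \<in> {0<..}"
    then show "eventually (\<lambda>x. x \<in> {0<..} \<and> x \<le> p) (at_right 0)" "eventually (\<lambda>x. x \<in> {0<..} \<and> p \<le> x) at_top"
      using eventually_at_right_real[of 0 p] eventually_mono[OF eventually_ge_at_top[of p], of "\<lambda>x. x \<in> {0<..} \<and> p \<le> x"]
      by (auto elim: eventually_mono)
  qed auto
  then show ?thesis by auto
qed

lemma F_has_two_zeros:
  assumes "1 < b" "b < 2"
  shows "\<exists>x y. 0 < x \<and> x < y \<and> F b x = 0 \<and> F b y = 0"
proof -
  have b: "0 < b" using assms by simp
  \<comment> \<open>\<open>z\<close> is also a zero of \<open>G b\<close>, so Rolle's theorem
    applies separately on (0, z) and beyond \<open>z\<close>.\<close>
  obtain z where z: "0 < z" "F (b - 1) z = 0" using F_has_zero[of "b - 1"] assms by auto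
  have "(G b \<longlongrightarrow> G b z) (at z within S)" for S
    using DERIV_isCont[OF G_deriv[OF b z(1)]] by (metis isCont_def tendsto_within_subset subset_UNIV)
  then have Gz: "(G b \<longlongrightarrow> 0) (at z within S)" for S using z by (simp add: G_def)
  have "\<exists>x\<in>{0<..<z}. F b x = 0"
  proof (rule G_rolle[OF b])
    show "(G b \<longlongrightarrow> 0) (at_right 0)" by (rule G_tendsto_0[OF b])
    show "(G b \<longlongrightarrow> 0) (at_left z)" by (rule Gz)
    fix p assume "p \<in> {0<..<z}"
    then show "eventually (\<lambda>x. x \<in> {0<..<z} \<and> x \<le> p) (at_right 0)" "eventually (\<lambda>x. x \<in> {0<..<z} \<and> p \<le> x) (at_left z)"
      using eventually_at_right_real[of 0 p] eventually_at_left_real[of p z]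
      by (auto elim!: eventually_mono)
  qed (use z in auto)
  moreover have "\<exists>x\<in>{z<..}. F b x = 0"
  proof (rule G_rolle[OF b])
    show "(G b \<longlongrightarrow> 0) (at_right z)" by (rule Gz)
    show "(G b \<longlongrightarrow> 0) at_top" unfolding G_def[abs_def] using F_decay assms by simp
    fix p assume "p \<in> {z<..}"
    then show "eventually (\<lambda>x. x \<in> {z<..} \<and> x \<le> p) (at_right z)" "eventually (\<lambda>x. x \<in> {z<..} \<and> p \<le> x) at_top"
      using eventually_at_right_real[of z p] eventually_mono[OF eventually_ge_at_top[of p], of "\<lambda>x. x \<in> {z<..} \<and> p \<le> x"]
      by (auto elim: eventually_mono)
  qed (use z in auto)
  ultimately show ?thesis using z(1) by (meson greaterThanLessThan_iff greaterThan_iff less_trans)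
qed

section \<open>Counting the zeros\<close>

lemma powr_root_cancel:
  assumes "0 < x"
  shows "(x powr (1 / (1 - a))) powr (1 - a) = x" "0 < x powr (1 / (1 - a))"
  using assms a by (simp_all add: powr_powr)

lemma F_at_most_one_zero:
  assumes b: "0 < b" "b \<le> 1" and xy: "0 < x" "x < y" and z: "F b x = 0" "F b y = 0"
  shows False
proof -
  let ?X = "\<lambda>x. x powr (1 / (1 - a))"
  have "?X x < ?X y" using xy a by (intro powr_less_mono2) auto
  moreover have "F b (?X x powr (1 - a)) = 0" "F b (?X y powr (1 - a)) = 0" "0 < ?X x"
    using xy z powr_root_cancel by simp_all
  ultimately show False
    using w_sign_change_le_1[OF b] sign0_no_zero[of b] sign1_one_zero[of b] b by (smt (verit))
qed

lemma F_at_most_two_zeros: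
  assumes b: "0 < b" "b < 2" and xyz: "0 < x" "x < y" "y < z" and zero: "F b x = 0" "F b y = 0" "F b z = 0"
  shows False
proof -
  let ?X = "\<lambda>x. x powr (1 / (1 - a))"
  have X: "0 < ?X x" "?X x < ?X y" "?X y < ?X z" using xyz a by (auto intro!: powr_less_mono2)
  have Z: "F b (?X x powr (1 - a)) = 0" "F b (?X y powr (1 - a)) = 0" "F b (?X z powr (1 - a)) = 0"
    using xyz zero powr_root_cancel by simp_all
  have b': "-1 < b" using b by simp
  from w_sign_change_le_2[OF b] show False
    using sign0_no_zero[OF b' _ X(1)] sign1_one_zero[OF b' _ X(1,2) Z(1,2)] sign2_two_zeros[OF b' _ X Z] Z by blast
qed

text \<open>With real parameters and argument every term of the complex series is real, so its sum
  is the embedded value of \<open>F\<close>.\<close>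

lemma num_pos_zeros_F:
  assumes "-1 < b"
  shows "num_pos_zeros (- a) (of_real (- b)) = card {x. 0 < x \<and> F b x = 0}"
proof -
  have "wright (- a) (of_real (- b)) (- of_real x) = of_real (F b x)" for x
  proof -
    have "(- complex_of_real x) ^ n / fact n * rGamma (complex_of_real (- b) + complex_of_real (- a) * of_nat n)
        = of_real ((- x) ^ n / fact n * rGamma (- b - a * n))" for n
      using rGamma_complex_of_real[of "- b - a * n"] by simp
    then show ?thesis
      unfolding wright_def using sums_unique[OF sums_of_real[OF F_sums(1)[OF assms, of x]], symmetric] by (simp only:)
  qed
  then show ?thesis by (simp add: num_pos_zeros_def)
qed

lemma num_pos_zeros_eq_1:
  assumes "0 < b" "b \<le> 1"
  shows "num_pos_zeros (- a) (of_real (- b)) = 1"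
proof -
  obtain x where x: "0 < x" "F b x = 0" using F_has_zero[of b] assms by auto
  have "{x. 0 < x \<and> F b x = 0} = {x}"
    using x F_at_most_one_zero[OF assms] by (auto, metis linorder_neqE_linordered_idom)
  then show ?thesis using num_pos_zeros_F[of b] assms by simp
qed

lemma num_pos_zeros_eq_2:
  assumes "1 < b" "b < 2"
  shows "num_pos_zeros (- a) (of_real (- b)) = 2"
proof -
  obtain x y where xy: "0 < x" "x < y" "F b x = 0" "F b y = 0" using F_has_two_zeros[OF assms] by auto
  have b: "0 < b" using assms by simp
  have "z = x \<or> z = y" if "0 < z" "F b z = 0" for z
    using F_at_most_two_zeros[OF b assms(2)] xy that by (metis linorder_neqE_linordered_idom)
  then have "{x. 0 < x \<and> F b x = 0} = {x, y}" using xy by auto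
  then show ?thesis using num_pos_zeros_F[of b] xy assms by simp
qed

end

theorem proposition2:
  fixes \<rho> :: real
  assumes "\<rho> \<in> {-1<..-1/2}"
  shows "(\<forall>\<beta>::real. \<beta> \<in> {-1..<0} \<longrightarrow> num_pos_zeros \<rho> (of_real \<beta>) = 1) \<and>
         (\<forall>\<beta>::real. \<beta> \<in> {2 * \<rho>..<-1} \<longrightarrow> num_pos_zeros \<rho> (of_real \<beta>) = 2)"
proof -
  interpret wright_index "- \<rho>" using assms by unfold_locales auto
  show ?thesis
  proof (intro conjI allI impI)
    fix \<beta> :: real assume "\<beta> \<in> {-1..<0}"
    then show "num_pos_zeros \<rho> (of_real \<beta>) = 1" using num_pos_zeros_eq_1[of "- \<beta>"] by simp
  next
    fix \<beta> :: real assume "\<beta> \<in> {2 * \<rho>..<-1}"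
    \<comment> \<open>Since \<open>\<rho> > -1\<close>, the bound
      \<open>\<beta> \<ge> 2 * \<rho>\<close> gives \<open>- \<beta> < 2\<close>.\<close>
    then show "num_pos_zeros \<rho> (of_real \<beta>) = 2" using num_pos_zeros_eq_2[of "- \<beta>"] assms by simp
  qed
qed

end
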